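(* Let $M^m$ be a compact $m$-dimensional submanifold of the unit Euclidean sphere $\mathbb{S}^n$ with constant mean curvature, $|H|^2=k$, where $H$ is the mean curvature vector field of $M$ in $\mathbb{S}^n$. Then $M$ is proper biharmonic in $\mathbb{S}^n$ if and only if one of the following holds: (a) $|H|^2=1$ and $M$ is a $1$-type submanifold of $\mathbb{R}^{n+1}$ with eigenvalue $\lambda=2m$; or (b) $|H|^2=k\in(0,1)$ and $M$ is a $2$-type submanifold of $\mathbb{R}^{n+1}$ with eigenvalues $\lambda_{1,2}=m(1\pm\sqrt{k})$.
   Context: Manifolds are connected and smooth. For a smooth map $\phi:(M,g)\to(N,h)$ between Riemannian manifolds, the tension field is $\tau(\phi)=\operatorname{trace}\nabla d\phi$ and the bitension field is $\tau_2(\phi)=-\Delta\tau(\phi)-\operatorname{trace}R^N(d\phi,\tau(\phi))d\phi$, where $\Delta=-\operatorname{trace}\nabla^2$ is the rough Laplacian on sections of $\phi^{-1}TN$ and $R^N(X,Y)=[\nabla_X,\nabla_Y]-\nabla_{[X,Y]}$. The map $\phi$ is harmonic if $\tau(\phi)=0$, biharmonic if $\tau_2(\phi)=0$, and proper biharmonic if it is biharmonic and not harmonic. A submanifold $M$ of $N$ (with induced metric) is called biharmonic (resp. proper biharmonic) if its inclusion map is biharmonic (resp. proper biharmonic); the inclusion is harmonic exactly when $M$ is minimal. The mean curvature vector field of $M^m$ is $H=\frac1m\operatorname{trace}B$, with $B$ the second fundamental form, so $\tau(\phi)=mH$ for the inclusion $\phi$; the mean curvature is $|H|$. The submanifold $M\subset\mathbb{S}^n$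 is viewed as a submanifold of $\mathbb{R}^{n+1}$ via $\mathbb{S}^n\subset\mathbb{R}^{n+1}$, with inclusion $\varphi:M\to\mathbb{R}^{n+1}$. Let $\Delta$ be the (nonnegative) Laplacian of $M$, acting componentwise on $\mathbb{R}^{n+1}$-valued functions. For compact $M$, an isometric immersion $\varphi:M\to\mathbb{R}^{n+1}$ is of $k$-type if its spectral decomposition with respect to $\Delta$ contains exactly $k$ non-zero terms, excepting the center of mass, that is, $\varphi=x_0+x_{1}+\dots+x_{k}$ with $x_0$ constant (the center of mass), $x_i$ non-zero, $\Delta x_i=\lambda_i x_i$, and the $\lambda_i>0$ distinct; the $\lambda_i$ are called the eigenvalues of the $k$-type submanifold. *)

theory Defs
  imports "HOL-Analysis.Analysis"
begin

text \<open>
  Riemannian manifolds are realised as embedded submanifolds of Euclidean spaces with the induced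
  metric; by the Nash embedding theorem this loses no generality. Maps and vector fields
  are functions on the ambient space of which only the values on the manifold matter. Vector fields
  along a map into \<open>N\<close> take values in the ambient space of \<open>N\<close>.
\<close>

subsection \<open>Smooth maps and submanifolds\<close>

text \<open>The next two notions are meant for open sets \<open>S\<close>.\<close>

primrec Ck_on :: "nat \<Rightarrow> 'a::euclidean_space set \<Rightarrow> ('a \<Rightarrow> 'b::real_normed_vector) \<Rightarrow> bool" where
  "Ck_on 0 S f \<longleftrightarrow> continuous_on S f"
| "Ck_on (Suc k) S f \<longleftrightarrow>
     f differentiable_on S \<and> (\<forall>v. Ck_on k S (\<lambda>x. frechet_derivative f (at x) v))"

definition smooth_on :: "'a::euclidean_space set \<Rightarrow> ('a \<Rightarrow> 'b::real_normed_vector) \<Rightarrow> bool" where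
  "smooth_on S f \<longleftrightarrow> (\<forall>k. Ck_on k S f)"

definition smooth_submanifold :: "nat \<Rightarrow> 'a::euclidean_space set \<Rightarrow> bool" where
  "smooth_submanifold m M \<longleftrightarrow>
     (\<forall>p\<in>M. \<exists>U V L. \<exists>F G :: 'a \<Rightarrow> 'a. open U \<and> p \<in> U \<and> open V \<and> homeomorphism U V F G \<and>
        smooth_on U F \<and> smooth_on V G \<and> subspace L \<and> dim L = m \<and> F ` (M \<inter> U) = L \<inter> V)"

definition smooth_map_on :: "'a::euclidean_space set \<Rightarrow> ('a \<Rightarrow> 'b::real_normed_vector) \<Rightarrow> bool" where
  "smooth_map_on M f \<longleftrightarrow>
     (\<forall>p\<in>M. \<exists>U F. open U \<and> p \<in> U \<and> smooth_on U F \<and> (\<forall>x\<in>M \<inter> U. F x = f x))"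

definition tangent_space :: "'a::euclidean_space set \<Rightarrow> 'a \<Rightarrow> 'a set" where
  "tangent_space M p =
     {v. \<exists>\<gamma> e. 0 < e \<and> smooth_on {-e<..<e} \<gamma> \<and> \<gamma> ` {-e<..<e} \<subseteq> M \<and> \<gamma> (0::real) = p \<and>
           (\<gamma> has_vector_derivative v) (at 0)}"

text \<open>
  The differential \<open>df\<^sub>p(v)\<close>. A derivative within \<open>M\<close> is determined only on the
  tangent space of \<open>M\<close> at \<open>p\<close>, so this is meaningful for tangent vectors \<open>v\<close> only.
\<close>

definition differential ::
    "'a::euclidean_space set \<Rightarrow> ('a \<Rightarrow> 'b::real_normed_vector) \<Rightarrow> 'a \<Rightarrow> 'a \<Rightarrow> 'b" where
  "differential M f p v = frechet_derivative f (at p within M) v"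

definition isometric_immersion ::
    "'a::euclidean_space set \<Rightarrow> 'b::euclidean_space set \<Rightarrow> ('a \<Rightarrow> 'b) \<Rightarrow> bool" where
  "isometric_immersion M N \<phi> \<longleftrightarrow>
     smooth_map_on M \<phi> \<and> \<phi> ` M \<subseteq> N \<and>
     (\<forall>p\<in>M. \<forall>v\<in>tangent_space M p. \<forall>w\<in>tangent_space M p.
        differential M \<phi> p v \<bullet> differential M \<phi> p w = v \<bullet> w)"

subsection \<open>Connections and traces\<close>

definition orth_proj :: "'a::euclidean_space set \<Rightarrow> 'a \<Rightarrow> 'a" where
  "orth_proj S x = (THE u. u \<in> S \<and> (\<forall>w\<in>S. orthogonal (x - u) w))"

text \<open>
  \<open>\<nabla>\<^sub>v V\<close> at \<open>p\<close> for the pull-back to \<open>\<phi>\<close> of the Levi-Civita connection of \<open>N\<close>, where \<open>V\<close> is a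
  vector field along \<open>\<phi>\<close>: for the metric induced by a Euclidean space this is the tangential part
  of the ordinary derivative.
\<close>

definition pullback_conn ::
    "'a::euclidean_space set \<Rightarrow> 'b::euclidean_space set \<Rightarrow> ('a \<Rightarrow> 'b) \<Rightarrow> ('a \<Rightarrow> 'b) \<Rightarrow> 'a \<Rightarrow> 'a \<Rightarrow> 'b"
  where
  "pullback_conn M N \<phi> V p v = orth_proj (tangent_space N (\<phi> p)) (differential M V p v)"

definition levi_civita :: "'a::euclidean_space set \<Rightarrow> ('a \<Rightarrow> 'a) \<Rightarrow> 'a \<Rightarrow> 'a \<Rightarrow> 'a" where
  "levi_civita M X p v = pullback_conn M M (\<lambda>q. q) X p v"

text \<open>
  A tangent vector field on \<open>M\<close> that equals \<open>w\<close> at a point \<open>p\<close> whenever \<open>w\<close> is tangent at \<open>p\<close>.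
  It is used to evaluate tensorial expressions, for which the choice of the extension is irrelevant.
\<close>

definition tangent_ext :: "'a::euclidean_space set \<Rightarrow> 'a \<Rightarrow> 'a \<Rightarrow> 'a" where
  "tangent_ext M w q = orth_proj (tangent_space M q) w"

definition orthonormal_basis_of :: "'a::euclidean_space set \<Rightarrow> 'a set \<Rightarrow> bool" where
  "orthonormal_basis_of S B \<longleftrightarrow>
     pairwise orthogonal B \<and> (\<forall>b\<in>B. norm b = 1) \<and> span B = S"

text \<open>The trace of a bilinear form on a subspace; it does not depend on the orthonormal basis.\<close>

definition trace_on ::
    "'a::euclidean_space set \<Rightarrow> ('a \<Rightarrow> 'a \<Rightarrow> 'b::real_normed_vector) \<Rightarrow> 'b" where
  "trace_on S b = (\<Sum>e\<in>(SOME B. orthonormal_basis_of S B). b e e)"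

subsection \<open>Curvature\<close>

definition lie_bracket ::
    "'a::euclidean_space set \<Rightarrow> ('a \<Rightarrow> 'a) \<Rightarrow> ('a \<Rightarrow> 'a) \<Rightarrow> 'a \<Rightarrow> 'a" where
  "lie_bracket N X Y q = differential N Y q (X q) - differential N X q (Y q)"

definition curvature ::
    "'a::euclidean_space set \<Rightarrow> 'a \<Rightarrow> 'a \<Rightarrow> 'a \<Rightarrow> 'a \<Rightarrow> 'a" where
  "curvature N y u v w =
     (let X = tangent_ext N u; Y = tangent_ext N v; Z = tangent_ext N w
      in levi_civita N (\<lambda>q. levi_civita N Z q (Y q)) y (X y)
         - levi_civita N (\<lambda>q. levi_civita N Z q (X q)) y (Y y)
         - levi_civita N Z y (lie_bracket N X Y y))"

subsection \<open>Harmonic and biharmonic maps\<close>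

text \<open>\<open>(\<nabla>d\<phi>)(v, W) = \<nabla>\<^sub>v (d\<phi>(W)) - d\<phi>(\<nabla>\<^sub>v W)\<close>\<close>

definition second_fundamental_form_map ::
    "'a::euclidean_space set \<Rightarrow> 'b::euclidean_space set \<Rightarrow> ('a \<Rightarrow> 'b) \<Rightarrow> 'a \<Rightarrow> 'a \<Rightarrow> 'a \<Rightarrow> 'b"
  where
  "second_fundamental_form_map M N \<phi> p v w =
     (let W = tangent_ext M w
      in pullback_conn M N \<phi> (\<lambda>q. differential M \<phi> q (W q)) p v
         - differential M \<phi> p (levi_civita M W p v))"

definition tension_field ::
    "'a::euclidean_space set \<Rightarrow> 'b::euclidean_space set \<Rightarrow> ('a \<Rightarrow> 'b) \<Rightarrow> 'a \<Rightarrow> 'b" where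
  "tension_field M N \<phi> p = trace_on (tangent_space M p) (second_fundamental_form_map M N \<phi> p)"

text \<open>\<open>(\<nabla>\<^sup>2V)(v, W) = \<nabla>\<^sub>v \<nabla>\<^sub>W V - \<nabla>\<^bsub>\<nabla>\<^sub>v W\<^esub> V\<close> for a vector field \<open>V\<close> along \<open>\<phi>\<close>\<close>

definition second_cov_deriv ::
    "'a::euclidean_space set \<Rightarrow> 'b::euclidean_space set \<Rightarrow> ('a \<Rightarrow> 'b) \<Rightarrow> ('a \<Rightarrow> 'b)
      \<Rightarrow> 'a \<Rightarrow> 'a \<Rightarrow> 'a \<Rightarrow> 'b" where
  "second_cov_deriv M N \<phi> V p v w =
     (let W = tangent_ext M w
      in pullback_conn M N \<phi> (\<lambda>q. pullback_conn M N \<phi> V q (W q)) p v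
         - pullback_conn M N \<phi> V p (levi_civita M W p v))"

definition rough_laplacian ::
    "'a::euclidean_space set \<Rightarrow> 'b::euclidean_space set \<Rightarrow> ('a \<Rightarrow> 'b) \<Rightarrow> ('a \<Rightarrow> 'b) \<Rightarrow> 'a \<Rightarrow> 'b" where
  "rough_laplacian M N \<phi> V p =
     - trace_on (tangent_space M p) (second_cov_deriv M N \<phi> V p)"

definition bitension_field ::
    "'a::euclidean_space set \<Rightarrow> 'b::euclidean_space set \<Rightarrow> ('a \<Rightarrow> 'b) \<Rightarrow> 'a \<Rightarrow> 'b" where
  "bitension_field M N \<phi> p =
     - rough_laplacian M N \<phi> (tension_field M N \<phi>) p
     - trace_on (tangent_space M p)
         (\<lambda>v w. curvature N (\<phi> p) (differential M \<phi> p v) (tension_field M N \<phi> p)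
                  (differential M \<phi> p w))"

definition harmonic_map ::
    "'a::euclidean_space set \<Rightarrow> 'b::euclidean_space set \<Rightarrow> ('a \<Rightarrow> 'b) \<Rightarrow> bool" where
  "harmonic_map M N \<phi> \<longleftrightarrow> (\<forall>p\<in>M. tension_field M N \<phi> p = 0)"

definition biharmonic_map ::
    "'a::euclidean_space set \<Rightarrow> 'b::euclidean_space set \<Rightarrow> ('a \<Rightarrow> 'b) \<Rightarrow> bool" where
  "biharmonic_map M N \<phi> \<longleftrightarrow> (\<forall>p\<in>M. bitension_field M N \<phi> p = 0)"

definition proper_biharmonic ::
    "'a::euclidean_space set \<Rightarrow> 'b::euclidean_space set \<Rightarrow> ('a \<Rightarrow> 'b) \<Rightarrow> bool" where
  "proper_biharmonic M N \<phi> \<longleftrightarrow> biharmonic_map M N \<phi> \<and> \<not> harmonic_map M N \<phi>"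

subsection \<open>Mean curvature\<close>

text \<open>
  For an isometric immersion \<open>\<phi>\<close> into \<open>N\<close>, \<open>B(v, w)\<close> is the component of \<open>\<nabla>\<^sup>N\<^sub>v W\<close>
  normal to the tangent space of the immersed submanifold.
\<close>

definition second_fundamental_form ::
    "'a::euclidean_space set \<Rightarrow> 'b::euclidean_space set \<Rightarrow> ('a \<Rightarrow> 'b) \<Rightarrow> 'a \<Rightarrow> 'a \<Rightarrow> 'a \<Rightarrow> 'b"
  where
  "second_fundamental_form M N \<phi> p v w =
     (let D = pullback_conn M N \<phi> (\<lambda>q. differential M \<phi> q (tangent_ext M w q)) p v
      in D - orth_proj (differential M \<phi> p ` tangent_space M p) D)"

definition mean_curvature_vector ::
    "nat \<Rightarrow> 'a::euclidean_space set \<Rightarrow> 'b::euclidean_space set \<Rightarrow> ('a \<Rightarrow> 'b) \<Rightarrow> 'a \<Rightarrow> 'b" where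
  "mean_curvature_vector m M N \<phi> p =
     (1 / real m) *\<^sub>R trace_on (tangent_space M p) (second_fundamental_form M N \<phi> p)"

subsection \<open>Laplacian and submanifolds of finite type\<close>

text \<open>
  The nonnegative Laplacian \<open>-trace \<nabla>df\<close> of \<open>M\<close>. For vector-valued \<open>f\<close> it acts componentwise,
  since all operations involved do.
\<close>

definition laplacian ::
    "'a::euclidean_space set \<Rightarrow> ('a \<Rightarrow> 'b::real_normed_vector) \<Rightarrow> 'a \<Rightarrow> 'b" where
  "laplacian M f p =
     - trace_on (tangent_space M p)
         (\<lambda>v w. let W = tangent_ext M w
                 in differential M (\<lambda>q. differential M f q (W q)) p v
                    - differential M f p (levi_civita M W p v))"

text \<open>
  \<open>M\<close>, immersed by \<open>\<phi>\<close>, is of \<open>k\<close>-type with set of eigenvalues \<open>\<Lambda>\<close>. The summands are indexed by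
  their eigenvalues, which makes these distinct.
\<close>

definition finite_type ::
    "'a::euclidean_space set \<Rightarrow> ('a \<Rightarrow> 'b::euclidean_space) \<Rightarrow> nat \<Rightarrow> real set \<Rightarrow> bool" where
  "finite_type M \<phi> k \<Lambda> \<longleftrightarrow>
     finite \<Lambda> \<and> card \<Lambda> = k \<and> (\<forall>\<mu>\<in>\<Lambda>. 0 < \<mu>) \<and>
     (\<exists>x0 x.
        (\<forall>\<mu>\<in>\<Lambda>. smooth_map_on M (x \<mu>) \<and> (\<exists>p\<in>M. x \<mu> p \<noteq> 0) \<and>
                 (\<forall>p\<in>M. laplacian M (x \<mu>) p = \<mu> *\<^sub>R x \<mu> p)) \<and>
        (\<forall>p\<in>M. \<phi> p = x0 + (\<Sum>\<mu>\<in>\<Lambda>. x \<mu> p)))"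

end

theory Submission
  imports Defs
begin

text \<open>
  Let \<open>\<phi>\<close> be the immersion, regarded as a map into Euclidean space, and \<open>\<tau> = m H\<close> its tension field as a map
  into the sphere. Projecting the Euclidean Hessian of \<open>\<phi>\<close> to the sphere only removes a multiple of \<open>\<phi>\<close>,
  so \<open>\<tau> = m \<phi> - \<Delta>\<phi>\<close> (\<open>tension_field_eq\<close>). The field \<open>\<tau>\<close> is orthogonal to \<open>\<phi>\<close> and to \<open>d\<phi>\<close>, hence its rough
  Laplacian is \<open>\<Delta>\<tau> + |\<tau>|\<^sup>2 \<phi>\<close>, and the curvature of the sphere contributes \<open>m \<tau>\<close>. With \<open>|\<tau>|\<^sup>2 = m\<^sup>2 k\<close> the
  bitension field becomes a polynomial in the Laplacian (\<open>bitension_laplacian\<close>):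
  \<open>\<tau>\<^sub>2 = \<Delta>\<^sup>2\<phi> - 2m \<Delta>\<phi> + m\<^sup>2 (1 - k) \<phi> = (\<Delta> - m (1 + \<surd>k)) (\<Delta> - m (1 - \<surd>k)) \<phi>\<close>.
  Since \<open>\<phi>\<close> is harmonic iff \<open>k = 0\<close>, what remains is to read this equation spectrally.

  If \<open>\<tau>\<^sub>2 = 0\<close>, then \<open>|d(m \<phi> + \<tau>)|\<^sup>2 = m\<^sup>3 (1 - k)\<close> (\<open>biharmonic_gradient_identity\<close>), so \<open>k \<le> 1\<close>. For
  \<open>k = 1\<close> the map \<open>m \<phi> + \<tau> = 2m \<phi> - \<Delta>\<phi>\<close> is constant by connectedness, and \<open>\<Delta>\<phi>\<close> is an eigenfunction for \<open>2m\<close>. For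
  \<open>0 < k < 1\<close> the two factors of the polynomial split \<open>\<phi>\<close> into eigenfunctions; neither vanishes,
  because \<open>\<phi> \<bullet> \<Delta>\<phi> = m\<close>.

  Conversely, a decomposition with these eigenvalues makes \<open>\<tau>\<^sub>2\<close> a constant vector \<open>c\<close>, a multiple of the
  center of mass (zero when \<open>k = 1\<close>). As \<open>\<tau>\<^sub>2\<close> is tangent to the sphere, \<open>c \<bullet> \<phi> = 0\<close> on \<open>M\<close>; applying the
  polynomial in \<open>\<Delta>\<close> to this function gives \<open>c \<bullet> c = 0\<close>.

  For the local calculus, frames are avoided: with \<open>P\<^sub>q\<close> the projection onto the tangent space at \<open>q\<close> and
  \<open>D\<^sub>i f (q) = df\<^sub>q (P\<^sub>q i)\<close> for \<open>i\<close> in the standard basis of the ambient space of \<open>M\<close>, one has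
  \<open>\<Delta>f = - \<Sum>\<^sub>i D\<^sub>i D\<^sub>i f\<close> (\<open>laplacian_eq\<close>). This rests on the smoothness of \<open>q \<mapsto> P\<^sub>q\<close> and on \<open>P (\<nabla>P) P = 0\<close>.
\<close>

section \<open>Calculus of \<open>C\<^sup>k\<close> functions on open sets\<close>

lemma frechet_derivative_cong_open:
  assumes "open S" "x \<in> S" "\<And>y. y \<in> S \<Longrightarrow> f y = g y"
  shows "frechet_derivative f (at x) = frechet_derivative g (at x)"
proof -
  have "(f has_derivative D) (at x) \<longleftrightarrow> (g has_derivative D) (at x)" for D
    using assms has_derivative_transform_within_open[of f D x UNIV S g]
      has_derivative_transform_within_open[of g D x UNIV S f] by auto
  then show ?thesis
    unfolding frechet_derivative_def by simp
qed

lemma Ck_on_cong: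
  assumes "open S" "\<And>x. x \<in> S \<Longrightarrow> f x = g x" "Ck_on k S f"
  shows "Ck_on k S g"
  using assms(2,3)
proof (induction k arbitrary: f g)
  case 0
  then show ?case using continuous_on_cong[of S S f g] by auto
next
  case (Suc k)
  have "g differentiable_on S"
    using Suc.prems differentiable_on_def differentiable_transform_within[of f _ S 1 g]
    by (metis Ck_on.simps(2) zero_less_one)
  moreover have "Ck_on k S (\<lambda>x. frechet_derivative g (at x) v)" for v
  proof (rule Suc.IH)
    show "frechet_derivative f (at x) v = frechet_derivative g (at x) v" if "x \<in> S" for x
      using frechet_derivative_cong_open[OF assms(1) that Suc.prems(1)] by simp
  qed (use Suc.prems in simp)
  ultimately show ?case by simp
qed

lemma Ck_on_Suc_intro:
  assumes "open S"
    and "\<And>x. x \<in> S \<Longrightarrow> (f has_derivative D x) (at x)"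
    and "\<And>v. Ck_on k S (\<lambda>x. D x v)"
  shows "Ck_on (Suc k) S f"
proof -
  have "f differentiable_on S"
    using assms(2) by (meson differentiable_def differentiable_at_imp_differentiable_on)
  moreover have "Ck_on k S (\<lambda>x. frechet_derivative f (at x) v)" for v
    using fun_cong[OF frechet_derivative_at[OF assms(2)]]
    by (intro Ck_on_cong[OF assms(1) _ assms(3)[of v]]) auto
  ultimately show ?thesis by simp
qed

lemma Ck_on_has_derivative:
  assumes "open S" "Ck_on (Suc k) S f" "x \<in> S"
  shows "(f has_derivative frechet_derivative f (at x)) (at x)"
  using assms by (simp add: differentiable_on_eq_differentiable_at frechet_derivative_works[symmetric])

lemma Ck_on_Suc_imp:
  assumes "open S" "Ck_on (Suc k) S f"
  shows "Ck_on k S f"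
  using assms(2)
proof (induction k arbitrary: f)
  case 0
  then show ?case using differentiable_imp_continuous_on by auto
next
  case (Suc k)
  then show ?case by (metis Ck_on.simps(2))
qed

lemma Ck_on_subset: "Ck_on k S f \<Longrightarrow> T \<subseteq> S \<Longrightarrow> Ck_on k T f"
  by (induction k arbitrary: f) (auto intro: continuous_on_subset differentiable_on_subset)

lemma Ck_on_const: "Ck_on k S (\<lambda>x. c)"
  by (induction k arbitrary: c) auto

lemma Ck_on_bounded_linear:
  assumes "open S" "bounded_linear h" "Ck_on k S f"
  shows "Ck_on k S (\<lambda>x. h (f x))"
  using assms(3)
proof (induction k arbitrary: f)
  case 0
  then show ?case using bounded_linear.continuous_on[OF assms(2)] by auto
next
  case (Suc k)
  show ?case
  proof (rule Ck_on_Suc_intro[OF assms(1)])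
    show "((\<lambda>x. h (f x)) has_derivative (\<lambda>v. h (frechet_derivative f (at x) v))) (at x)"
      if "x \<in> S" for x
      using bounded_linear.has_derivative[OF assms(2) Ck_on_has_derivative[OF assms(1) Suc.prems that]] .
  qed (use Suc assms in auto)
qed

lemma Ck_on_add:
  assumes "open S" "Ck_on k S f" "Ck_on k S g"
  shows "Ck_on k S (\<lambda>x. f x + g x)"
  using assms(2,3)
proof (induction k arbitrary: f g)
  case 0
  then show ?case by (auto intro: continuous_on_add)
next
  case (Suc k)
  show ?case
  proof (rule Ck_on_Suc_intro[OF assms(1)])
    show "((\<lambda>x. f x + g x) has_derivative
        (\<lambda>v. frechet_derivative f (at x) v + frechet_derivative g (at x) v)) (at x)"
      if "x \<in> S" for x
      using Ck_on_has_derivative[OF assms(1) _ that] Suc.prems by (intro has_derivative_add)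
  qed (use Suc assms in auto)
qed

lemma Ck_on_bilinear:
  assumes "open S" "bounded_bilinear pr" "Ck_on k S f" "Ck_on k S g"
  shows "Ck_on k S (\<lambda>x. pr (f x) (g x))"
  using assms(3,4)
proof (induction k arbitrary: f g)
  case 0
  then show ?case using bounded_bilinear.continuous_on[OF assms(2)] by auto
next
  case (Suc k)
  show ?case
  proof (rule Ck_on_Suc_intro[OF assms(1)])
    show "((\<lambda>x. pr (f x) (g x)) has_derivative
        (\<lambda>v. pr (f x) (frechet_derivative g (at x) v) + pr (frechet_derivative f (at x) v) (g x)))
        (at x)"
      if "x \<in> S" for x
      by (rule bounded_bilinear.FDERIV[OF assms(2) Ck_on_has_derivative[OF assms(1) Suc.prems(1) that]
            Ck_on_has_derivative[OF assms(1) Suc.prems(2) that]])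
    show "Ck_on k S (\<lambda>x. pr (f x) (frechet_derivative g (at x) v)
        + pr (frechet_derivative f (at x) v) (g x))" for v
      using Suc.prems Ck_on_Suc_imp[OF assms(1) Suc.prems(1)] Ck_on_Suc_imp[OF assms(1) Suc.prems(2)]
      by (intro Ck_on_add assms(1) Suc.IH) auto
  qed
qed

lemma Ck_on_inverse:
  fixes f :: "'a::euclidean_space \<Rightarrow> real"
  assumes "open S" "\<And>x. x \<in> S \<Longrightarrow> f x \<noteq> 0" "Ck_on k S f"
  shows "Ck_on k S (\<lambda>x. inverse (f x))"
  using assms(3)
proof (induction k)
  case 0
  then show ?case using assms(2) by (auto intro: continuous_on_inverse)
next
  case (Suc k)
  note mult = Ck_on_bilinear[OF assms(1) bounded_bilinear_mult]
  show ?case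
  proof (rule Ck_on_Suc_intro[OF assms(1)])
    show "((\<lambda>x. inverse (f x)) has_derivative
        (\<lambda>v. - (inverse (f x) * frechet_derivative f (at x) v * inverse (f x)))) (at x)"
      if "x \<in> S" for x
      by (rule Deriv.has_derivative_inverse[where f=f and x=x, OF assms(2)[OF that]
            Ck_on_has_derivative[OF assms(1) Suc.prems that]])
    show "Ck_on k S (\<lambda>x. - (inverse (f x) * frechet_derivative f (at x) v * inverse (f x)))" for v
      using Suc Ck_on_Suc_imp[OF assms(1) Suc.prems]
      by (intro Ck_on_bounded_linear[OF assms(1) bounded_linear_minus[OF bounded_linear_ident]] mult)
        auto
  qed
qed

lemma smooth_on_has_derivative:
  assumes "open S" "smooth_on S f" "x \<in> S"
  shows "(f has_derivative frechet_derivative f (at x)) (at x)"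
  using assms Ck_on_has_derivative unfolding smooth_on_def by blast

lemma smooth_on_derivative: "smooth_on S f \<Longrightarrow> smooth_on S (\<lambda>x. frechet_derivative f (at x) v)"
  unfolding smooth_on_def by (metis Ck_on.simps(2))

lemma smooth_on_imp_continuous_on: "smooth_on S f \<Longrightarrow> continuous_on S f"
  unfolding smooth_on_def by (metis Ck_on.simps(1))

lemma smooth_on_subset: "smooth_on S f \<Longrightarrow> T \<subseteq> S \<Longrightarrow> smooth_on T f"
  unfolding smooth_on_def using Ck_on_subset by blast

lemma smooth_on_const: "smooth_on S (\<lambda>x. c)"
  unfolding smooth_on_def using Ck_on_const by blast

lemma smooth_on_bounded_linear:
  "open S \<Longrightarrow> bounded_linear h \<Longrightarrow> smooth_on S f \<Longrightarrow> smooth_on S (\<lambda>x. h (f x))"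
  unfolding smooth_on_def using Ck_on_bounded_linear by blast

lemma smooth_on_add:
  "open S \<Longrightarrow> smooth_on S f \<Longrightarrow> smooth_on S g \<Longrightarrow> smooth_on S (\<lambda>x. f x + g x)"
  unfolding smooth_on_def using Ck_on_add by blast

lemma smooth_on_bilinear:
  "open S \<Longrightarrow> bounded_bilinear pr \<Longrightarrow> smooth_on S f \<Longrightarrow> smooth_on S g
    \<Longrightarrow> smooth_on S (\<lambda>x. pr (f x) (g x))"
  unfolding smooth_on_def using Ck_on_bilinear by blast

lemma smooth_on_inverse:
  fixes f :: "'a::euclidean_space \<Rightarrow> real"
  shows "open S \<Longrightarrow> (\<And>x. x \<in> S \<Longrightarrow> f x \<noteq> 0) \<Longrightarrow> smooth_on S f
    \<Longrightarrow> smooth_on S (\<lambda>x. inverse (f x))"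
  unfolding smooth_on_def using Ck_on_inverse by blast

lemma smooth_on_diff:
  assumes "open S" "smooth_on S f" "smooth_on S g"
  shows "smooth_on S (\<lambda>x. f x - g x)"
  using smooth_on_add[OF assms(1,2)
      smooth_on_bounded_linear[OF assms(1) bounded_linear_minus[OF bounded_linear_ident] assms(3)]]
  by simp

lemma smooth_on_sum:
  assumes "open S" "\<And>i. i \<in> I \<Longrightarrow> smooth_on S (f i)"
  shows "smooth_on S (\<lambda>x. \<Sum>i\<in>I. f i x)"
  using assms(2)
  by (induction I rule: infinite_finite_induct) (auto intro: smooth_on_const smooth_on_add[OF assms(1)])

lemma linear_sum_Basis:
  fixes D :: "'a::euclidean_space \<Rightarrow> 'b::real_vector"
  assumes "linear D"
  shows "D v = (\<Sum>b\<in>Basis. (v \<bullet> b) *\<^sub>R D b)"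
  by (subst euclidean_representation[of v, symmetric])
    (simp add: linear_sum[OF assms] linear_scale[OF assms])

text \<open>
  Smoothness is defined through derivatives in constant directions; a variable direction is
  expanded in the standard basis.
\<close>

lemma smooth_on_derivative_field:
  assumes "open S" "smooth_on S f" "smooth_on S X"
  shows "smooth_on S (\<lambda>x. frechet_derivative f (at x) (X x))"
proof -
  have "smooth_on S (\<lambda>x. \<Sum>b\<in>Basis. (X x \<bullet> b) *\<^sub>R frechet_derivative f (at x) b)"
    by (intro smooth_on_sum smooth_on_bilinear[OF assms(1) bounded_bilinear_scaleR]
        smooth_on_derivative smooth_on_bounded_linear[OF assms(1) bounded_linear_inner_left] assms)
  moreover have "frechet_derivative f (at x) (X x)
      = (\<Sum>b\<in>Basis. (X x \<bullet> b) *\<^sub>R frechet_derivative f (at x) b)" if "x \<in> S" for x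
    using linear_sum_Basis has_derivative_linear smooth_on_has_derivative[OF assms(1,2) that] by blast
  ultimately show ?thesis
    unfolding smooth_on_def by (metis (no_types, lifting) Ck_on_cong[OF assms(1)])
qed

text \<open>
  Both iterated derivatives are limits of the same second difference quotient, which two
  applications of the mean value theorem turn into a value of either of them at a nearby point.
\<close>

lemma second_difference_mvt:
  fixes f :: "'a::euclidean_space \<Rightarrow> real"
  assumes "smooth_on S f" "open S" "0 < t"
    and S: "\<And>a b. 0 \<le> a \<Longrightarrow> a \<le> t \<Longrightarrow> 0 \<le> b \<Longrightarrow> b \<le> t \<Longrightarrow> p + a *\<^sub>R v + b *\<^sub>R w \<in> S"
  obtains a b where "0 \<le> a" "a \<le> t" "0 \<le> b" "b \<le> t"
    "f (p + t *\<^sub>R v + t *\<^sub>R w) - f (p + t *\<^sub>R v) - f (p + t *\<^sub>R w) + f p =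
    t * t * frechet_derivative (\<lambda>x. frechet_derivative f (at x) v) (at (p + a *\<^sub>R v + b *\<^sub>R w)) w"
proof -
  have D: "((\<lambda>s. F (c s)) has_real_derivative D') (at a)"
    if "(c has_derivative c') (at a)" "smooth_on S F" "c a \<in> S"
      "\<And>s. s * D' = frechet_derivative F (at (c a)) (c' s)"
    for F :: "'a \<Rightarrow> real" and c c' D' a
    using has_derivative_compose[OF that(1) smooth_on_has_derivative[OF assms(2) that(2,3)]] that(4)
    by (rule has_derivative_imp_has_field_derivative)
  have D1: "((\<lambda>s. f (p + s *\<^sub>R v + b *\<^sub>R w)) has_real_derivative
      frechet_derivative f (at (p + a *\<^sub>R v + b *\<^sub>R w)) v) (at a)"
    if "0 \<le> a" "a \<le> t" "0 \<le> b" "b \<le> t" for a b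
  proof (rule D[where F=f and c="\<lambda>s. p + s *\<^sub>R v + b *\<^sub>R w" and a=a, OF _ assms(1) S[OF that]])
    show "((\<lambda>s. p + s *\<^sub>R v + b *\<^sub>R w) has_derivative (\<lambda>s. s *\<^sub>R v)) (at a)"
      by (auto intro!: derivative_eq_intros)
    show "s * frechet_derivative f (at (p + a *\<^sub>R v + b *\<^sub>R w)) v =
         frechet_derivative f (at (p + a *\<^sub>R v + b *\<^sub>R w)) (s *\<^sub>R v)" for s
      using has_derivative_linear[OF smooth_on_has_derivative[OF assms(2,1) S[OF that]]]
      by (simp add: linear_scale)
  qed
  let ?g = "\<lambda>x. frechet_derivative f (at x) v"
  have sg: "smooth_on S ?g" using assms(1) by (rule smooth_on_derivative)
  have D2: "((\<lambda>s. ?g (p + a *\<^sub>R v + s *\<^sub>R w)) has_real_derivative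
      frechet_derivative ?g (at (p + a *\<^sub>R v + b *\<^sub>R w)) w) (at b)"
    if "0 \<le> a" "a \<le> t" "0 \<le> b" "b \<le> t" for a b
  proof (rule D[where F="?g" and c="\<lambda>s. p + a *\<^sub>R v + s *\<^sub>R w" and a=b, OF _ sg S[OF that]])
    show "((\<lambda>s. p + a *\<^sub>R v + s *\<^sub>R w) has_derivative (\<lambda>s. s *\<^sub>R w)) (at b)"
      by (auto intro!: derivative_eq_intros)
    show "s * frechet_derivative ?g (at (p + a *\<^sub>R v + b *\<^sub>R w)) w =
         frechet_derivative ?g (at (p + a *\<^sub>R v + b *\<^sub>R w)) (s *\<^sub>R w)" for s
      using has_derivative_linear[OF smooth_on_has_derivative[OF assms(2) sg S[OF that]]]
      by (simp add: linear_scale)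
  qed
  have "\<exists>a. 0 < a \<and> a < t \<and>
    (f (p + t *\<^sub>R v + t *\<^sub>R w) - f (p + t *\<^sub>R v + 0 *\<^sub>R w)) - (f (p + 0 *\<^sub>R v + t *\<^sub>R w) - f (p + 0 *\<^sub>R v + 0 *\<^sub>R w))
     = (t - 0) * (?g (p + a *\<^sub>R v + t *\<^sub>R w) - ?g (p + a *\<^sub>R v + 0 *\<^sub>R w))"
    by (rule MVT2[OF assms(3)]) (use assms(3) in \<open>auto intro!: DERIV_diff D1 simp del: scaleR_zero_left\<close>)
  then obtain a where a: "0 < a" "a < t"
    "f (p + t *\<^sub>R v + t *\<^sub>R w) - f (p + t *\<^sub>R v) - f (p + t *\<^sub>R w) + f p
     = t * (?g (p + a *\<^sub>R v + t *\<^sub>R w) - ?g (p + a *\<^sub>R v + 0 *\<^sub>R w))"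
    by auto
  have "\<exists>b. 0 < b \<and> b < t \<and> ?g (p + a *\<^sub>R v + t *\<^sub>R w) - ?g (p + a *\<^sub>R v + 0 *\<^sub>R w)
     = (t - 0) * frechet_derivative ?g (at (p + a *\<^sub>R v + b *\<^sub>R w)) w"
    by (rule MVT2[OF assms(3)]) (use a in \<open>auto intro!: D2\<close>)
  then obtain b where b: "0 < b" "b < t" "?g (p + a *\<^sub>R v + t *\<^sub>R w) - ?g (p + a *\<^sub>R v + 0 *\<^sub>R w)
     = t * frechet_derivative ?g (at (p + a *\<^sub>R v + b *\<^sub>R w)) w"
    by auto
  show ?thesis
    by (rule that[of a b]) (use a b in \<open>simp_all del: scaleR_zero_left\<close>)
qed

lemma isCont_ball:
  fixes h :: "'a::metric_space \<Rightarrow> 'b::metric_space"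
  assumes "isCont h p" "0 < e"
  obtains d where "0 < d" "\<And>x. dist x p < d \<Longrightarrow> dist (h x) (h p) < e"
  using assms unfolding continuous_at_eps_delta by blast

lemma second_derivative_symmetric_real:
  fixes f :: "'a::euclidean_space \<Rightarrow> real"
  assumes f: "smooth_on S f" and "open S" "p \<in> S"
  shows "frechet_derivative (\<lambda>x. frechet_derivative f (at x) v) (at p) w =
    frechet_derivative (\<lambda>x. frechet_derivative f (at x) w) (at p) v" (is "?A p = ?B p")
proof -
  have cont: "isCont ?A p" "isCont ?B p"
    using smooth_on_imp_continuous_on[OF smooth_on_derivative[OF smooth_on_derivative[OF f]]]
      assms(2,3) continuous_on_eq_continuous_at by blast+
  have near: "\<exists>d>0. \<forall>t. 0 < t \<and> t < d \<longrightarrow>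
      (\<forall>a b. 0 \<le> a \<longrightarrow> a \<le> t \<longrightarrow> 0 \<le> b \<longrightarrow> b \<le> t \<longrightarrow> p + a *\<^sub>R v + b *\<^sub>R w \<in> ball p e)" if "0 < e" for e
  proof (intro exI[of _ "e / (1 + norm v + norm w)"] conjI allI impI)
    have pos: "0 < 1 + norm v + norm w"
      by (simp add: add_pos_nonneg)
    then show "0 < e / (1 + norm v + norm w)" using that by simp
    \<comment> \<open>The radius above bounds the size of the parallelogram spanned by \<open>t v\<close> and \<open>t w\<close>.\<close>
    fix t a b :: real
    assume t: "0 < t \<and> t < e / (1 + norm v + norm w)" and ab: "0 \<le> a" "a \<le> t" "0 \<le> b" "b \<le> t"
    have "norm (a *\<^sub>R v + b *\<^sub>R w) \<le> a * norm v + b * norm w"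
      using ab by (metis abs_of_nonneg norm_scaleR norm_triangle_ineq)
    also have "\<dots> \<le> t * norm v + t * norm w"
      using ab by (intro add_mono mult_right_mono) auto
    also have "\<dots> \<le> t * (1 + norm v + norm w)"
      using t by (simp add: algebra_simps)
    also have "\<dots> < e" using t pos by (simp add: pos_less_divide_eq)
    finally have "norm (- (a *\<^sub>R v + b *\<^sub>R w)) < e"
      by (simp only: norm_minus_cancel)
    moreover have "p - (p + a *\<^sub>R v + b *\<^sub>R w) = - (a *\<^sub>R v + b *\<^sub>R w)" by simp
    ultimately show "p + a *\<^sub>R v + b *\<^sub>R w \<in> ball p e"
      by (simp only: mem_ball dist_norm)
  qed
  have "\<bar>?A p - ?B p\<bar> < e" if "0 < e" for e
  proof -
    obtain r where r: "0 < r" "ball p r \<subseteq> S"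
      using assms(2,3) openE by blast
    obtain d1 where d1: "0 < d1" "\<And>x. dist x p < d1 \<Longrightarrow> dist (?A x) (?A p) < e / 2"
      using isCont_ball[OF cont(1), of "e / 2"] \<open>0 < e\<close> by (metis half_gt_zero)
    obtain d2 where d2: "0 < d2" "\<And>x. dist x p < d2 \<Longrightarrow> dist (?B x) (?B p) < e / 2"
      using isCont_ball[OF cont(2), of "e / 2"] \<open>0 < e\<close> by (metis half_gt_zero)
    define \<delta> where "\<delta> = min r (min d1 d2)"
    have "0 < \<delta>" using r d1 d2 by (simp add: \<delta>_def)
    obtain d where d: "0 < d" "\<And>t a b. 0 < t \<Longrightarrow> t < d \<Longrightarrow> 0 \<le> a \<Longrightarrow> a \<le> t \<Longrightarrow> 0 \<le> b \<Longrightarrow> b \<le> t \<Longrightarrow>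
        p + a *\<^sub>R v + b *\<^sub>R w \<in> ball p \<delta>"
      using near[OF \<open>0 < \<delta>\<close>] by blast
    define t where "t = d / 2"
    have t: "0 < t" "t < d" using d by (auto simp: t_def)
    have inS: "p + a *\<^sub>R v + b *\<^sub>R w \<in> S" if "0 \<le> a" "a \<le> t" "0 \<le> b" "b \<le> t" for a b
      using d(2)[OF t that] r by (auto simp: \<delta>_def)
    have inS': "p + b *\<^sub>R w + a *\<^sub>R v \<in> S" if "0 \<le> b" "b \<le> t" "0 \<le> a" "a \<le> t" for a b
      using inS[OF that(3,4,1,2)] by (simp add: algebra_simps)
    obtain a b where ab: "0 \<le> a" "a \<le> t" "0 \<le> b" "b \<le> t" 
      "f (p + t *\<^sub>R v + t *\<^sub>R w) - f (p + t *\<^sub>R v) - f (p + t *\<^sub>R w) + f p = t * t * ?A (p + a *\<^sub>R v + b *\<^sub>R w)"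
      by (rule second_difference_mvt[OF f assms(2) t(1) inS])
    obtain a' b' where ab': "0 \<le> a'" "a' \<le> t" "0 \<le> b'" "b' \<le> t" 
      "f (p + t *\<^sub>R w + t *\<^sub>R v) - f (p + t *\<^sub>R w) - f (p + t *\<^sub>R v) + f p = t * t * ?B (p + b' *\<^sub>R w + a' *\<^sub>R v)"
      by (rule second_difference_mvt[OF f assms(2) t(1) inS'])
    have "t * t * ?A (p + a *\<^sub>R v + b *\<^sub>R w) = t * t * ?B (p + b' *\<^sub>R w + a' *\<^sub>R v)"
      using ab(5) ab'(5) by (simp add: algebra_simps)
    then have "?A (p + a *\<^sub>R v + b *\<^sub>R w) = ?B (p + a' *\<^sub>R v + b' *\<^sub>R w)"
      using t(1) by (simp add: algebra_simps)
    moreover have "dist (?A (p + a *\<^sub>R v + b *\<^sub>R w)) (?A p) < e / 2"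
      using d(2)[OF t ab(1-4)] by (intro d1) (simp add: \<delta>_def dist_commute)
    moreover have "dist (?B (p + a' *\<^sub>R v + b' *\<^sub>R w)) (?B p) < e / 2"
      using d(2)[OF t ab'(1-4)] by (intro d2) (simp add: \<delta>_def dist_commute)
    ultimately show ?thesis
      unfolding dist_real_def by linarith
  qed
  then have "\<not> 0 < \<bar>?A p - ?B p\<bar>" by (metis order_less_irrefl)
  then show ?thesis by simp
qed

lemma frechet_derivative_bounded_linear:
  assumes "open S" "smooth_on S f" "x \<in> S" "bounded_linear h"
  shows "frechet_derivative (\<lambda>x. h (f x)) (at x) v = h (frechet_derivative f (at x) v)"
  using frechet_derivative_at[OF bounded_linear.has_derivative[OF assms(4)
    smooth_on_has_derivative[OF assms(1-3)]]] by metis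

lemma second_derivative_symmetric:
  fixes f :: "'a::euclidean_space \<Rightarrow> 'b::euclidean_space"
  assumes f: "smooth_on S f" and "open S" "p \<in> S"
  shows "frechet_derivative (\<lambda>x. frechet_derivative f (at x) v) (at p) w =
    frechet_derivative (\<lambda>x. frechet_derivative f (at x) w) (at p) v"
proof (rule euclidean_eqI)
  fix b :: 'b assume "b \<in> Basis"
  have "frechet_derivative (\<lambda>x. frechet_derivative f (at x) v) (at p) w \<bullet> b =
    frechet_derivative (\<lambda>x. frechet_derivative (\<lambda>x. f x \<bullet> b) (at x) v) (at p) w" for v w
  proof -
    have "frechet_derivative (\<lambda>x. frechet_derivative f (at x) v) (at p) w \<bullet> b =
      frechet_derivative (\<lambda>x. frechet_derivative f (at x) v \<bullet> b) (at p) w"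
      by (rule frechet_derivative_bounded_linear[OF assms(2) smooth_on_derivative[OF f] assms(3)
          bounded_linear_inner_left, symmetric])
    also have "\<dots> = frechet_derivative (\<lambda>x. frechet_derivative (\<lambda>x. f x \<bullet> b) (at x) v) (at p) w"
      by (intro fun_cong[OF frechet_derivative_cong_open[OF assms(2,3)]]
          frechet_derivative_bounded_linear[OF assms(2) f _ bounded_linear_inner_left, symmetric])
    finally show ?thesis .
  qed
  then show "frechet_derivative (\<lambda>x. frechet_derivative f (at x) v) (at p) w \<bullet> b =
    frechet_derivative (\<lambda>x. frechet_derivative f (at x) w) (at p) v \<bullet> b"
    using second_derivative_symmetric_real[OF smooth_on_bounded_linear[OF assms(2)
        bounded_linear_inner_left f] assms(2,3)] by simp
qed

section \<open>Smooth maps on subsets and their differentials\<close>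

lemma smooth_map_on_localE:
  assumes "smooth_map_on M f" "p \<in> M"
  obtains U F where "open U" "p \<in> U" "smooth_on U F" "\<forall>x\<in>M \<inter> U. F x = f x"
  using assms unfolding smooth_map_on_def by blast

lemma smooth_map_onI:
  assumes "\<And>p. p \<in> M \<Longrightarrow> \<exists>U F. open U \<and> p \<in> U \<and> smooth_on U F \<and> (\<forall>x\<in>M \<inter> U. F x = f x)"
  shows "smooth_map_on M f"
  using assms unfolding smooth_map_on_def by blast

lemma smooth_map_on_cong:
  assumes "smooth_map_on M f" "\<And>q. q \<in> M \<Longrightarrow> f q = g q"
  shows "smooth_map_on M g"
proof (rule smooth_map_onI)
  fix p assume "p \<in> M"
  then obtain U F where "open U" "p \<in> U" "smooth_on U F" "\<forall>x\<in>M \<inter> U. F x = f x"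
    by (rule smooth_map_on_localE[OF assms(1)])
  then show "\<exists>U F. open U \<and> p \<in> U \<and> smooth_on U F \<and> (\<forall>x\<in>M \<inter> U. F x = g x)"
    using assms(2) by (intro exI[of _ U] exI[of _ F]) auto
qed

lemma smooth_map_on_const: "smooth_map_on M (\<lambda>q. c)"
  by (rule smooth_map_onI) (auto intro!: exI[of _ UNIV] exI[of _ "\<lambda>_. c"] smooth_on_const)

lemma smooth_map_on_bilinear:
  assumes "bounded_bilinear pr" "smooth_map_on M f" "smooth_map_on M g"
  shows "smooth_map_on M (\<lambda>q. pr (f q) (g q))"
proof (rule smooth_map_onI)
  fix p assume p: "p \<in> M"
  obtain U F where F: "open U" "p \<in> U" "smooth_on U F" "\<forall>x\<in>M \<inter> U. F x = f x"
    by (rule smooth_map_on_localE[OF assms(2) p])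
  obtain V G where G: "open V" "p \<in> V" "smooth_on V G" "\<forall>x\<in>M \<inter> V. G x = g x"
    by (rule smooth_map_on_localE[OF assms(3) p])
  have "smooth_on (U \<inter> V) (\<lambda>x. pr (F x) (G x))"
    by (rule smooth_on_bilinear[OF open_Int[OF F(1) G(1)] assms(1)])
      (auto intro: smooth_on_subset[OF F(3)] smooth_on_subset[OF G(3)])
  with F G show "\<exists>U F. open U \<and> p \<in> U \<and> smooth_on U F \<and> (\<forall>x\<in>M \<inter> U. F x = pr (f x) (g x))"
    by (intro exI[of _ "U \<inter> V"] exI[of _ "\<lambda>x. pr (F x) (G x)"]) auto
qed

lemma smooth_map_on_bounded_linear:
  assumes "bounded_linear h" "smooth_map_on M f"
  shows "smooth_map_on M (\<lambda>q. h (f q))"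
proof (rule smooth_map_onI)
  fix p assume p: "p \<in> M"
  obtain U F where F: "open U" "p \<in> U" "smooth_on U F" "\<forall>x\<in>M \<inter> U. F x = f x"
    by (rule smooth_map_on_localE[OF assms(2) p])
  then show "\<exists>U F. open U \<and> p \<in> U \<and> smooth_on U F \<and> (\<forall>x\<in>M \<inter> U. F x = h (f x))"
    using smooth_on_bounded_linear[OF F(1) assms(1) F(3)]
    by (intro exI[of _ U] exI[of _ "\<lambda>x. h (F x)"]) auto
qed

lemma smooth_map_on_add:
  assumes "smooth_map_on M f" "smooth_map_on M g"
  shows "smooth_map_on M (\<lambda>q. f q + g q)"
proof (rule smooth_map_onI)
  fix p assume p: "p \<in> M"
  obtain U F where F: "open U" "p \<in> U" "smooth_on U F" "\<forall>x\<in>M \<inter> U. F x = f x"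
    by (rule smooth_map_on_localE[OF assms(1) p])
  obtain V G where G: "open V" "p \<in> V" "smooth_on V G" "\<forall>x\<in>M \<inter> V. G x = g x"
    by (rule smooth_map_on_localE[OF assms(2) p])
  have "smooth_on (U \<inter> V) (\<lambda>x. F x + G x)"
    by (rule smooth_on_add[OF open_Int[OF F(1) G(1)]])
      (auto intro: smooth_on_subset[OF F(3)] smooth_on_subset[OF G(3)])
  with F G show "\<exists>U F. open U \<and> p \<in> U \<and> smooth_on U F \<and> (\<forall>x\<in>M \<inter> U. F x = f x + g x)"
    by (intro exI[of _ "U \<inter> V"] exI[of _ "\<lambda>x. F x + G x"]) auto
qed

lemma smooth_map_on_minus: "smooth_map_on M f \<Longrightarrow> smooth_map_on M (\<lambda>q. - f q)"
  by (rule smooth_map_on_bounded_linear[OF bounded_linear_minus[OF bounded_linear_ident]])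

lemma smooth_map_on_scaleR: "smooth_map_on M f \<Longrightarrow> smooth_map_on M (\<lambda>q. c *\<^sub>R f q)"
  by (rule smooth_map_on_bounded_linear[OF bounded_linear_scaleR_right])

lemma smooth_map_on_diff:
  "smooth_map_on M f \<Longrightarrow> smooth_map_on M g \<Longrightarrow> smooth_map_on M (\<lambda>q. f q - g q)"
  using smooth_map_on_add[OF _ smooth_map_on_minus, of M f g] by simp

lemma smooth_map_on_sum:
  "(\<And>i. i \<in> I \<Longrightarrow> smooth_map_on M (f i)) \<Longrightarrow> smooth_map_on M (\<lambda>q. \<Sum>i\<in>I. f i q)"
  by (induction I rule: infinite_finite_induct) (auto intro: smooth_map_on_const smooth_map_on_add)

lemma has_derivative_transform_within_nhd:
  assumes "open U" "p \<in> U" "p \<in> M" "\<forall>x\<in>M \<inter> U. f x = g x"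
    and "(f has_derivative D) (at p within M)"
  shows "(g has_derivative D) (at p within M)"
proof -
  obtain d where "0 < d" "ball p d \<subseteq> U"
    using assms(1,2) openE by blast
  then show ?thesis
    using assms(4)
    by (intro has_derivative_transform_within[OF assms(5) _ assms(3)])
      (auto simp: dist_commute subset_iff)
qed

lemma differential_cong:
  assumes "open U" "p \<in> U" "p \<in> M" "\<forall>x\<in>M \<inter> U. f x = g x"
  shows "differential M f p v = differential M g p v"
proof -
  have "(f has_derivative D) (at p within M) \<longleftrightarrow> (g has_derivative D) (at p within M)" for D
    using has_derivative_transform_within_nhd[OF assms, of D]
      has_derivative_transform_within_nhd[OF assms(1-3), of g f D] assms(4) by auto
  then show ?thesis
    unfolding differential_def frechet_derivative_def by simp
qed

lemma differential_cong_on: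
  assumes "p \<in> M" "\<And>x. x \<in> M \<Longrightarrow> f x = g x"
  shows "differential M f p v = differential M g p v"
  using differential_cong[of UNIV p M f g] assms by simp

lemma smooth_map_on_has_derivative:
  assumes "smooth_map_on M f" "p \<in> M"
  shows "(f has_derivative differential M f p) (at p within M)"
proof -
  obtain U F where F: "open U" "p \<in> U" "smooth_on U F" "\<forall>x\<in>M \<inter> U. F x = f x"
    by (rule smooth_map_on_localE[OF assms])
  have "(f has_derivative frechet_derivative F (at p)) (at p within M)"
    by (rule has_derivative_transform_within_nhd[OF F(1,2) assms(2) F(4)
          has_derivative_at_withinI[OF smooth_on_has_derivative[OF F(1,3,2)]]])
  then have "f differentiable (at p within M)"
    by (auto simp: differentiable_def)
  then show ?thesis
    unfolding frechet_derivative_works differential_def[abs_def] .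
qed

lemma differential_linear: "smooth_map_on M f \<Longrightarrow> p \<in> M \<Longrightarrow> linear (differential M f p)"
  by (rule has_derivative_linear[OF smooth_map_on_has_derivative])

lemma tangent_curve_derivative:
  assumes \<gamma>: "0 < e" "\<gamma> ` {-e<..<e} \<subseteq> M" "\<gamma> 0 = p" "(\<gamma> has_vector_derivative v) (at 0)"
    and f: "(f has_derivative D) (at p within M)"
  shows "((\<lambda>t. f (\<gamma> t)) has_vector_derivative D v) (at (0::real))"
proof -
  let ?I = "{-e<..<e}"
  have "(\<gamma> has_derivative (\<lambda>t. t *\<^sub>R v)) (at 0 within ?I)"
    using \<gamma>(4) unfolding has_vector_derivative_def by (rule has_derivative_at_withinI)
  moreover have "(f has_derivative D) (at (\<gamma> 0) within \<gamma> ` ?I)"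
    using has_derivative_subset[OF f \<gamma>(2)] \<gamma>(3) by simp
  ultimately have "((\<lambda>t. f (\<gamma> t)) has_derivative (\<lambda>t. D (t *\<^sub>R v))) (at 0 within ?I)"
    by (rule has_derivative_in_compose[where g = f])
  moreover have "at 0 within ?I = at (0::real)"
    by (rule at_within_open) (use \<gamma>(1) in auto)
  ultimately show ?thesis
    unfolding has_vector_derivative_def by (simp add: linear_scale[OF has_derivative_linear[OF f]])
qed

text \<open>
  A derivative within \<open>M\<close> is not unique, but along a tangent vector it is: there it is the
  velocity of the image of a curve in \<open>M\<close>.
\<close>

lemma differential_eq:
  assumes "(f has_derivative D) (at p within M)" "v \<in> tangent_space M p"
  shows "differential M f p v = D v"
proof -
  obtain \<gamma> e where \<gamma>: "0 < e" "\<gamma> ` {-e<..<e} \<subseteq> M" "\<gamma> (0::real) = p" "(\<gamma> has_vector_derivative v) (at 0)"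
    using assms(2) unfolding tangent_space_def by auto
  have "f differentiable (at p within M)"
    using assms(1) by (auto simp: differentiable_def)
  then have "(f has_derivative differential M f p) (at p within M)"
    unfolding frechet_derivative_works differential_def[abs_def] .
  from tangent_curve_derivative[OF \<gamma> this] tangent_curve_derivative[OF \<gamma> assms(1)]
  show ?thesis by (rule vector_derivative_unique_at)
qed

lemma differential_const: "v \<in> tangent_space M p \<Longrightarrow> differential M (\<lambda>q. c) p v = 0"
  by (rule differential_eq) auto

lemma differential_local:
  assumes "open U" "smooth_on U F" "p \<in> U" "p \<in> M" "\<forall>x\<in>M \<inter> U. F x = f x"
    and "v \<in> tangent_space M p"
  shows "differential M f p v = frechet_derivative F (at p) v"
  by (rule differential_eq[OF has_derivative_transform_within_nhd[OF assms(1,3,4,5)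
      has_derivative_at_withinI[OF smooth_on_has_derivative[OF assms(1-3)]]] assms(6)])

context
  fixes M :: "'a::euclidean_space set" and p v
  assumes p: "p \<in> M" and v: "v \<in> tangent_space M p"
begin

lemma differential_bounded_linear:
  assumes "bounded_linear h" "smooth_map_on M f"
  shows "differential M (\<lambda>q. h (f q)) p v = h (differential M f p v)"
  by (rule differential_eq[OF bounded_linear.has_derivative[OF assms(1)
    smooth_map_on_has_derivative[OF assms(2) p]] v])

lemma differential_bilinear:
  assumes "bounded_bilinear pr" "smooth_map_on M f" "smooth_map_on M g"
  shows "differential M (\<lambda>q. pr (f q) (g q)) p v
    = pr (f p) (differential M g p v) + pr (differential M f p v) (g p)"
  by (rule differential_eq[OF bounded_bilinear.FDERIV[OF assms(1)
    smooth_map_on_has_derivative[OF assms(2) p] smooth_map_on_has_derivative[OF assms(3) p]] v])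

lemma differential_add:
  assumes "smooth_map_on M f" "smooth_map_on M g"
  shows "differential M (\<lambda>q. f q + g q) p v = differential M f p v + differential M g p v"
  by (rule differential_eq[OF has_derivative_add[OF
    smooth_map_on_has_derivative[OF assms(1) p] smooth_map_on_has_derivative[OF assms(2) p]] v])

lemma differential_sum:
  assumes "\<And>i. i \<in> I \<Longrightarrow> smooth_map_on M (f i)"
  shows "differential M (\<lambda>q. \<Sum>i\<in>I. f i q) p v = (\<Sum>i\<in>I. differential M (f i) p v)"
  by (rule differential_eq[OF has_derivative_sum v]) (rule smooth_map_on_has_derivative[OF assms p])

lemmas differential_inner = differential_bilinear[OF bounded_bilinear_inner]
lemmas differential_scaleR_field = differential_bilinear[OF bounded_bilinear_scaleR]

end

lemma smooth_map_on_differential: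
  assumes "smooth_map_on M f" "smooth_map_on M X" "\<And>q. q \<in> M \<Longrightarrow> X q \<in> tangent_space M q"
  shows "smooth_map_on M (\<lambda>q. differential M f q (X q))"
proof (rule smooth_map_onI)
  fix p assume p: "p \<in> M"
  obtain U F where F: "open U" "p \<in> U" "smooth_on U F" "\<forall>x\<in>M \<inter> U. F x = f x"
    by (rule smooth_map_on_localE[OF assms(1) p])
  obtain V Y where Y: "open V" "p \<in> V" "smooth_on V Y" "\<forall>x\<in>M \<inter> V. Y x = X x"
    by (rule smooth_map_on_localE[OF assms(2) p])
  have "smooth_on (U \<inter> V) (\<lambda>x. frechet_derivative F (at x) (Y x))"
    using F Y by (intro smooth_on_derivative_field) (auto intro: smooth_on_subset)
  moreover have "frechet_derivative F (at x) (Y x) = differential M f x (X x)" if "x \<in> M \<inter> (U \<inter> V)" for x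
    using differential_local[OF F(1,3) _ _ F(4), of x "X x"] assms(3) Y(4) that by auto
  ultimately show "\<exists>U F. open U \<and> p \<in> U \<and> smooth_on U F \<and> (\<forall>x\<in>M \<inter> U. F x = differential M f x (X x))"
    using F Y by (intro exI[of _ "U \<inter> V"] exI[of _ "\<lambda>x. frechet_derivative F (at x) (Y x)"]) auto
qed

text \<open>
  The product rule for \<open>x \<mapsto> Df(x)(X x)\<close>: first \<open>X\<close> is frozen, then \<open>Df\<close>.
\<close>

lemma derivative_of_directional_derivative:
  assumes "open S" "smooth_on S f" "smooth_on S X" "p \<in> S"
  shows "frechet_derivative (\<lambda>x. frechet_derivative f (at x) (X x)) (at p) v =
    frechet_derivative (\<lambda>x. frechet_derivative f (at x) (X p)) (at p) v +
    frechet_derivative f (at p) (frechet_derivative X (at p) v)"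
proof -
  let ?D = "\<lambda>b x. frechet_derivative f (at x) b"
  let ?R = "\<lambda>Y x. \<Sum>b\<in>Basis. (Y x \<bullet> b) *\<^sub>R ?D b x"
  have R: "?D (Y x) x = ?R Y x" if "x \<in> S" for x and Y :: "'a \<Rightarrow> 'a"
    by (rule linear_sum_Basis[OF has_derivative_linear[OF smooth_on_has_derivative[OF assms(1,2) that]]])
  have "frechet_derivative (\<lambda>x. ?D (Y x) x) (at p) v =
      (\<Sum>b\<in>Basis. (Y p \<bullet> b) *\<^sub>R frechet_derivative (?D b) (at p) v
         + (frechet_derivative Y (at p) v \<bullet> b) *\<^sub>R ?D b p)"
    if Y: "smooth_on S Y" for Y
  proof -
    have "(?R Y has_derivative (\<lambda>v. \<Sum>b\<in>Basis. (Y p \<bullet> b) *\<^sub>R frechet_derivative (?D b) (at p) v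
         + (frechet_derivative Y (at p) v \<bullet> b) *\<^sub>R ?D b p)) (at p)"
      by (intro has_derivative_sum has_derivative_scaleR
          bounded_linear.has_derivative[OF bounded_linear_inner_left]
          smooth_on_has_derivative[OF assms(1) _ assms(4)] Y smooth_on_derivative assms(2))
    then have "frechet_derivative (?R Y) (at p) = (\<lambda>v. \<Sum>b\<in>Basis. (Y p \<bullet> b) *\<^sub>R frechet_derivative (?D b) (at p) v
         + (frechet_derivative Y (at p) v \<bullet> b) *\<^sub>R ?D b p)"
      by (rule frechet_derivative_at[symmetric])
    moreover have "frechet_derivative (\<lambda>x. ?D (Y x) x) (at p) = frechet_derivative (?R Y) (at p)"
      by (rule frechet_derivative_cong_open[OF assms(1,4)]) (rule R)
    ultimately show ?thesis by simp
  qed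
  note this[OF assms(3)] this[OF smooth_on_const[of S "X p"]]
  moreover have "frechet_derivative f (at p) (frechet_derivative X (at p) v)
      = (\<Sum>b\<in>Basis. (frechet_derivative X (at p) v \<bullet> b) *\<^sub>R ?D b p)"
    by (rule R[OF assms(4)])
  ultimately show ?thesis
    by (simp add: sum.distrib)
qed

section \<open>Orthogonal projections\<close>

lemma orth_proj_eqI:
  assumes "subspace S" "u \<in> S" "\<And>w. w \<in> S \<Longrightarrow> (x - u) \<bullet> w = 0"
  shows "orth_proj S x = u"
  unfolding orth_proj_def
proof (rule the_equality)
  show "u \<in> S \<and> (\<forall>w\<in>S. orthogonal (x - u) w)"
    using assms by (simp add: orthogonal_def)
  fix u' assume u': "u' \<in> S \<and> (\<forall>w\<in>S. orthogonal (x - u') w)"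
  then have "u' - u \<in> S" using assms by (simp add: subspace_diff)
  then have "(x - u) \<bullet> (u' - u) - (x - u') \<bullet> (u' - u) = 0"
    using u' assms(3) by (simp add: orthogonal_def)
  then have "(u' - u) \<bullet> (u' - u) = 0" by (simp add: algebra_simps)
  then show "u' = u" by simp
qed

context
  fixes S :: "'a::euclidean_space set"
  assumes S: "subspace S"
begin

lemma orth_proj_props: "orth_proj S x \<in> S \<and> (\<forall>w\<in>S. (x - orth_proj S x) \<bullet> w = 0)"
proof -
  obtain y z where "y \<in> span S" "\<And>w. w \<in> span S \<Longrightarrow> orthogonal z w" "x = y + z"
    using orthogonal_subspace_decomp_exists by metis
  moreover have "span S = S" using S by simp
  ultimately have "y \<in> S" "\<And>w. w \<in> S \<Longrightarrow> (x - y) \<bullet> w = 0"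
    by (auto simp: orthogonal_def)
  then show ?thesis using orth_proj_eqI[OF S] by metis
qed

lemma orth_proj_in: "orth_proj S x \<in> S"
  using orth_proj_props by blast

lemma orth_proj_inner: "w \<in> S \<Longrightarrow> orth_proj S x \<bullet> w = x \<bullet> w"
  using orth_proj_props[of x] by (simp add: inner_diff_left)

lemma orth_proj_self: "x \<in> S \<Longrightarrow> orth_proj S x = x"
  by (rule orth_proj_eqI[OF S]) auto

lemma orth_proj_eq_0: "(\<And>w. w \<in> S \<Longrightarrow> x \<bullet> w = 0) \<Longrightarrow> orth_proj S x = 0"
  by (rule orth_proj_eqI[OF S]) (auto simp: subspace_0[OF S])

lemma orth_proj_linear: "linear (orth_proj S)"
proof (rule linearI)
  show "orth_proj S (x + y) = orth_proj S x + orth_proj S y" for x y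
    using orth_proj_in orth_proj_inner
    by (intro orth_proj_eqI[OF S]) (auto simp: subspace_add[OF S] algebra_simps)
  show "orth_proj S (c *\<^sub>R x) = c *\<^sub>R orth_proj S x" for c x
    using orth_proj_in orth_proj_inner
    by (intro orth_proj_eqI[OF S]) (auto simp: subspace_scale[OF S] algebra_simps)
qed

end

text \<open>
  Rejection of a vector from the span of a list, by Gram-Schmidt orthogonalisation. The vectors are
  not normalised, so that only reciprocals, and no square roots, have to be smooth.
\<close>

fun rejection :: "'a::euclidean_space list \<Rightarrow> 'a \<Rightarrow> 'a" where
  "rejection [] x = x"
| "rejection (n # ns) x = rejection ns x
     - (rejection ns x \<bullet> rejection ns n * inverse (rejection ns n \<bullet> rejection ns n)) *\<^sub>R rejection ns n"

lemma rejection_span: "x - rejection ns x \<in> span (set ns)"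
proof (induction ns arbitrary: x)
  case Nil
  then show ?case by (simp add: span_zero)
next
  case (Cons n ns)
  let ?T = "span (set (n # ns))"
  have sub: "span (set ns) \<subseteq> ?T" by (intro span_mono) auto
  have "n - (n - rejection ns n) \<in> ?T"
    by (rule span_diff) (use Cons.IH[of n] sub in \<open>auto intro: span_base\<close>)
  then have "c *\<^sub>R rejection ns n \<in> ?T" for c
    by (simp add: span_scale del: list.set)
  then have "(x - rejection ns x) + c *\<^sub>R rejection ns n \<in> ?T" for c
    using Cons.IH[of x] sub by (meson span_add subsetD)
  then show ?case by (simp add: algebra_simps)
qed

lemma rejection_orthogonal: "n \<in> set ns \<Longrightarrow> rejection ns x \<bullet> n = 0"
proof (induction ns arbitrary: x n)
  case (Cons n' ns)
  let ?u = "rejection ns n'"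
  have span: "rejection ns y \<bullet> z = 0" if "z \<in> span (set ns)" for y z
    using orthogonal_to_span[OF that, of "rejection ns y"] Cons.IH
    by (auto simp: orthogonal_def)
  have n': "rejection ns y \<bullet> n' = rejection ns y \<bullet> ?u" for y
    using span[OF rejection_span[of n' ns], of y] by (simp add: inner_diff_right)
  show ?case
  proof (cases "n \<in> set ns")
    case True
    then show ?thesis using Cons.IH by (simp add: inner_diff_left)
  next
    case False
    then have "n = n'" using Cons.prems by simp
    then show ?thesis by (cases "?u = 0") (auto simp: inner_diff_left n')
  qed
qed simp

lemma smooth_on_rejection:
  assumes "open U" "distinct ws" "independent (set ws)"
    and "\<And>w. w \<in> set ws \<Longrightarrow> smooth_on U (\<lambda>q. A q w)"
    and "\<And>q. q \<in> U \<Longrightarrow> linear (A q)" "\<And>q. q \<in> U \<Longrightarrow> inj (A q)"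
    and "smooth_on U X"
  shows "smooth_on U (\<lambda>q. rejection (map (A q) ws) (X q))"
  using assms(2-4,7)
proof (induction ws arbitrary: X)
  case (Cons w ws)
  have "independent (set ws)"
    using Cons.prems(2) independent_mono by (metis set_subset_Cons)
  with Cons have IH: "smooth_on U (\<lambda>q. rejection (map (A q) ws) (Y q))" if "smooth_on U Y" for Y
    using that by auto
  let ?r = "\<lambda>q. rejection (map (A q) ws) (X q)"
  let ?u = "\<lambda>q. rejection (map (A q) ws) (A q w)"
  have r: "smooth_on U ?r" and u: "smooth_on U ?u"
    using Cons.prems IH by auto
  have "w \<notin> span (set ws)"
    using Cons.prems(1,2) by (auto simp: independent_insert)
  \<comment> \<open>By independence the next vector to orthogonalise is not in the span of the others.\<close>
  have "?u q \<noteq> 0" if "q \<in> U" for q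
  proof
    assume "?u q = 0"
    then have "A q w \<in> span (A q ` set ws)"
      using rejection_span[of "A q w" "map (A q) ws"] by simp
    then have "A q w \<in> A q ` span (set ws)"
      by (simp add: span_linear_image assms(5)[OF that])
    then show False
      using \<open>w \<notin> span (set ws)\<close> assms(6)[OF that] by (auto dest: injD)
  qed
  then have "smooth_on U (\<lambda>q. inverse (?u q \<bullet> ?u q))"
    by (intro smooth_on_inverse smooth_on_bilinear[OF assms(1) bounded_bilinear_inner] u assms(1)) auto
  then have "smooth_on U (\<lambda>q. ?r q - (?r q \<bullet> ?u q * inverse (?u q \<bullet> ?u q)) *\<^sub>R ?u q)"
    by (intro smooth_on_diff smooth_on_bilinear[OF assms(1) bounded_bilinear_scaleR]
      smooth_on_bilinear[OF assms(1) bounded_bilinear_mult]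
      smooth_on_bilinear[OF assms(1) bounded_bilinear_inner] assms(1) r u)
  then show ?case by simp
qed simp

section \<open>Tangent spaces of submanifolds\<close>

lemma subspace_mem_iff_orthogonal:
  fixes L :: "'a::euclidean_space set"
  assumes "subspace L"
  shows "x \<in> L \<longleftrightarrow> (\<forall>w. (\<forall>l\<in>L. l \<bullet> w = 0) \<longrightarrow> x \<bullet> w = 0)"
  using orthogonal_comp_self[OF assms] unfolding orthogonal_comp_def orthogonal_def
  by (auto simp: inner_commute set_eq_iff)

text \<open>
  Pairing \<open>f\<close> with a vector orthogonal to \<open>L\<close> gives a function that is zero on \<open>M\<close> near \<open>p\<close>, and along
  tangent vectors the derivative depends on the values on \<open>M\<close> only.
\<close>

lemma derivative_in_subspace:
  fixes L :: "'b::euclidean_space set"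
  assumes "(f has_derivative D) (at p within M)" "p \<in> M" "v \<in> tangent_space M p"
    and "open U" "p \<in> U" "\<forall>x\<in>M \<inter> U. f x \<in> L" "subspace L"
  shows "D v \<in> L"
  unfolding subspace_mem_iff_orthogonal[OF assms(7)]
proof (intro allI impI)
  fix w assume w: "\<forall>l\<in>L. l \<bullet> w = 0"
  have 1: "((\<lambda>x. f x \<bullet> w) has_derivative (\<lambda>v. D v \<bullet> w)) (at p within M)"
    by (rule bounded_linear.has_derivative[OF bounded_linear_inner_left assms(1)])
  have "\<forall>x\<in>M \<inter> U. f x \<bullet> w = 0" using w assms(6) by blast
  then have "((\<lambda>x. 0) has_derivative (\<lambda>v. D v \<bullet> w)) (at p within M)"
    by (rule has_derivative_transform_within_nhd[OF assms(4,5,2) _ 1])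
  then have "differential M (\<lambda>x. 0) p v = D v \<bullet> w"
    by (rule differential_eq[OF _ assms(3)])
  then show "D v \<bullet> w = 0"
    by (simp add: differential_const[OF assms(3)])
qed

lemma smooth_on_line:
  fixes c a :: "'a::euclidean_space"
  assumes "open V" "smooth_on V G" "open I" "\<And>t. t \<in> I \<Longrightarrow> c + t *\<^sub>R a \<in> V"
  shows "smooth_on I (\<lambda>t. G (c + t *\<^sub>R a))"
proof -
  have "Ck_on k I (\<lambda>t. G (c + t *\<^sub>R a))" if "Ck_on k V G" for k
    using that
  proof (induction k arbitrary: G)
    case 0
    then show ?case
      using assms(4) by (auto intro!: continuous_on_compose2[of V G] continuous_intros)
  next
    case (Suc k)
    show ?case
    proof (rule Ck_on_Suc_intro[OF assms(3)])
      fix t assume t: "t \<in> I"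
      have "((\<lambda>t. c + t *\<^sub>R a) has_derivative (\<lambda>s. s *\<^sub>R a)) (at t)"
        by (auto intro!: derivative_eq_intros)
      moreover note G = Ck_on_has_derivative[OF assms(1) Suc.prems assms(4)[OF t]]
      ultimately have "((\<lambda>t. G (c + t *\<^sub>R a)) has_derivative
          (\<lambda>s. frechet_derivative G (at (c + t *\<^sub>R a)) (s *\<^sub>R a))) (at t)"
        by (rule has_derivative_compose)
      then show "((\<lambda>t. G (c + t *\<^sub>R a)) has_derivative
          (\<lambda>s. s *\<^sub>R frechet_derivative G (at (c + t *\<^sub>R a)) a)) (at t)"
        by (simp add: linear_scale[OF has_derivative_linear[OF G]])
    next
      show "Ck_on k I (\<lambda>t. s *\<^sub>R frechet_derivative G (at (c + t *\<^sub>R a)) a)" for s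
        using Suc by (intro Ck_on_bounded_linear[OF assms(3) bounded_linear_scaleR_right] Suc.IH) simp
    qed
  qed
  then show ?thesis using assms(2) unfolding smooth_on_def by blast
qed

locale submanifold_chart =
  fixes M U V L :: "'a::euclidean_space set" and F G :: "'a \<Rightarrow> 'a"
  assumes open_U: "open U" and open_V: "open V" and homeo: "homeomorphism U V F G"
    and smooth_F: "smooth_on U F" and smooth_G: "smooth_on V G"
    and subspace_L: "subspace L" and image_F: "F ` (M \<inter> U) = L \<inter> V"
begin

abbreviation "DF q \<equiv> frechet_derivative F (at q)"
abbreviation "DG q \<equiv> frechet_derivative G (at q)"

lemma GF: "x \<in> U \<Longrightarrow> G (F x) = x" and FG: "y \<in> V \<Longrightarrow> F (G y) = y"
  and F_in: "x \<in> U \<Longrightarrow> F x \<in> V" and G_in: "y \<in> V \<Longrightarrow> G y \<in> U"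
  using homeo unfolding homeomorphism_def by auto

lemma F_in_L: "x \<in> M \<inter> U \<Longrightarrow> F x \<in> L"
  using image_F by blast

lemma G_in_M: "y \<in> L \<Longrightarrow> y \<in> V \<Longrightarrow> G y \<in> M"
  using image_F GF by (metis IntD1 IntD2 IntI imageE)

lemma F_deriv: "q \<in> U \<Longrightarrow> (F has_derivative DF q) (at q)"
  by (rule smooth_on_has_derivative[OF open_U smooth_F])

lemma G_deriv: "y \<in> V \<Longrightarrow> (G has_derivative DG y) (at y)"
  by (rule smooth_on_has_derivative[OF open_V smooth_G])

lemma DG_DF: "q \<in> U \<Longrightarrow> DG (F q) (DF q v) = v"
proof -
  assume q: "q \<in> U"
  have "((\<lambda>x. G (F x)) has_derivative (\<lambda>v. DG (F q) (DF q v))) (at q)"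
    by (rule has_derivative_compose[OF F_deriv[OF q] G_deriv[OF F_in[OF q]]])
  then have "((\<lambda>x. x) has_derivative (\<lambda>v. DG (F q) (DF q v))) (at q)"
    by (rule has_derivative_transform_within_open[OF _ open_U q]) (rule GF)
  then have "(\<lambda>v. DG (F q) (DF q v)) = (\<lambda>v. v)"
    by (rule has_derivative_unique) (rule has_derivative_ident)
  then show ?thesis by metis
qed

lemma DF_DG: "y \<in> V \<Longrightarrow> DF (G y) (DG y v) = v"
proof -
  assume y: "y \<in> V"
  have "((\<lambda>x. F (G x)) has_derivative (\<lambda>v. DF (G y) (DG y v))) (at y)"
    by (rule has_derivative_compose[OF G_deriv[OF y] F_deriv[OF G_in[OF y]]])
  then have "((\<lambda>x. x) has_derivative (\<lambda>v. DF (G y) (DG y v))) (at y)"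
    by (rule has_derivative_transform_within_open[OF _ open_V y]) (rule FG)
  then have "(\<lambda>v. DF (G y) (DG y v)) = (\<lambda>v. v)"
    by (rule has_derivative_unique) (rule has_derivative_ident)
  then show ?thesis by metis
qed

lemma line_derivative:
  assumes "c + t *\<^sub>R a \<in> V"
  shows "((\<lambda>t. G (c + t *\<^sub>R a)) has_vector_derivative DG (c + t *\<^sub>R a) a) (at t)"
proof -
  have "((\<lambda>t. c + t *\<^sub>R a) has_derivative (\<lambda>s. s *\<^sub>R a)) (at t)"
    by (auto intro!: derivative_eq_intros)
  from has_derivative_compose[OF this G_deriv[OF assms]] show ?thesis
    unfolding has_vector_derivative_def
    by (simp add: linear_scale[OF has_derivative_linear[OF G_deriv[OF assms]]])
qed

lemma tangent_of_line:
  assumes "c \<in> L" "c \<in> V" "a \<in> L"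
  shows "DG c a \<in> tangent_space M (G c)"
proof -
  have "open ((\<lambda>t. c + t *\<^sub>R a) -` V)"
    by (rule open_vimage[OF open_V]) (intro continuous_intros)
  moreover have "0 \<in> (\<lambda>t. c + t *\<^sub>R a) -` V" using assms by simp
  ultimately obtain e where e: "0 < e" "ball 0 e \<subseteq> (\<lambda>t. c + t *\<^sub>R a) -` V"
    using openE by blast
  have inV: "c + t *\<^sub>R a \<in> V" if "t \<in> {-e<..<e}" for t
    using e(2) that by (auto simp: subset_iff dist_real_def)
  have "smooth_on {-e<..<e} (\<lambda>t. G (c + t *\<^sub>R a))"
    by (rule smooth_on_line[OF open_V smooth_G _ inV]) auto
  moreover have "(\<lambda>t. G (c + t *\<^sub>R a)) ` {-e<..<e} \<subseteq> M"
    by (auto intro!: G_in_M inV subspace_add[OF subspace_L] subspace_scale[OF subspace_L] assms)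
  moreover have "((\<lambda>t. G (c + t *\<^sub>R a)) has_vector_derivative DG c a) (at 0)"
    using line_derivative[of c 0 a] assms(2) by simp
  ultimately show ?thesis
    using e(1) unfolding tangent_space_def
    by (intro CollectI exI[of _ "\<lambda>t. G (c + t *\<^sub>R a)"] exI[of _ e]) auto
qed

text \<open>
  The chart maps curves in \<open>M\<close> to curves in \<open>L\<close>, and conversely every vector of \<open>L\<close> is the velocity of a
  straight line in \<open>L\<close>, whose image under the inverse chart is a curve in \<open>M\<close>.
\<close>

lemma tangent_space_eq:
  assumes "q \<in> M" "q \<in> U"
  shows "tangent_space M q = {v. DF q v \<in> L}"
proof (intro set_eqI iffI)
  fix v assume "v \<in> tangent_space M q"
  then show "v \<in> {v. DF q v \<in> L}"
    using derivative_in_subspace[OF has_derivative_at_withinI[OF F_deriv[OF assms(2)]] assms(1) _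
        open_U assms(2) _ subspace_L] F_in_L by auto
next
  fix v assume "v \<in> {v. DF q v \<in> L}"
  then have "DG (F q) (DF q v) \<in> tangent_space M (G (F q))"
    using assms by (intro tangent_of_line F_in_L F_in) auto
  then show "v \<in> tangent_space M q"
    using assms by (simp add: GF DG_DF)
qed

lemma linear_DF: "q \<in> U \<Longrightarrow> linear (DF q)"
  by (rule has_derivative_linear[OF F_deriv])

lemma subspace_tangent: "q \<in> M \<Longrightarrow> q \<in> U \<Longrightarrow> subspace (tangent_space M q)"
  using linear_subspace_vimage[OF linear_DF subspace_L] by (simp add: tangent_space_eq vimage_def)

lemma dim_tangent:
  assumes "q \<in> M" "q \<in> U"
  shows "dim (tangent_space M q) = dim L"
proof -
  have "DF q ` tangent_space M q = L"
  proof
    show "L \<subseteq> DF q ` tangent_space M q"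
    proof
      fix l assume "l \<in> L"
      then have "l = DF q (DG (F q) l)" "DG (F q) l \<in> tangent_space M q"
        using DF_DG[OF F_in[OF assms(2)], of l] assms by (simp_all add: GF tangent_space_eq)
      then show "l \<in> DF q ` tangent_space M q" by blast
    qed
  qed (auto simp: tangent_space_eq[OF assms])
  moreover have "inj_on (DF q) (span (tangent_space M q))"
    by (rule inj_onI) (metis DG_DF assms(2))
  ultimately show ?thesis
    using dim_image_eq[OF linear_DF[OF assms(2)]] by metis
qed

text \<open>
  The normal space at \<open>q\<close> is spanned by the images under the adjoint of \<open>DF q\<close> of a basis of the
  orthogonal complement of \<open>L\<close>, that is, by the gradients of the functions defining \<open>M\<close> near \<open>q\<close>.
  Rejection from these smooth independent fields is the tangential projection.
\<close>

lemma smooth_tangent_ext_local: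
  "\<exists>W. smooth_on U W \<and> (\<forall>q\<in>M \<inter> U. W q = tangent_ext M x q)"
proof -
  define L' where "L' = {w. \<forall>l\<in>L. l \<bullet> w = 0}"
  have "subspace L'"
    unfolding L'_def subspace_def by (auto simp: inner_add_right)
  obtain B where B: "B \<subseteq> L'" "independent B" "span B = L'"
    using basis_exists[of L'] \<open>subspace L'\<close> by (metis span_eq_iff span_mono subset_antisym)
  obtain ws where ws: "set ws = B" "distinct ws"
    using finite_distinct_list[OF independent_imp_finite[OF B(2)]] by blast
  let ?A = "\<lambda>q w. \<Sum>b\<in>Basis. (DF q b \<bullet> w) *\<^sub>R b"
  have A: "?A q w \<bullet> v = w \<bullet> DF q v" if "q \<in> U" for q w v
  proof -
    have "w \<bullet> DF q v = (\<Sum>b\<in>Basis. (v \<bullet> b) * (DF q b \<bullet> w))"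
      by (subst linear_sum_Basis[OF linear_DF[OF that]]) (simp add: inner_sum_right inner_commute)
    also have "\<dots> = ?A q w \<bullet> v"
      unfolding inner_sum_left inner_scaleR_left by (intro sum.cong refl) (simp add: inner_commute)
    finally show ?thesis by simp
  qed
  have linA: "linear (?A q)" for q
    by (rule linearI) (simp_all add: inner_add_right scaleR_left_distrib sum.distrib scaleR_sum_right)
  have "?A q w = ?A q w' \<Longrightarrow> w = w'" if "q \<in> U" for q w w'
  proof -
    assume "?A q w = ?A q w'"
    then have "w \<bullet> DF q v = w' \<bullet> DF q v" for v
      using A[OF that] by metis
    from this[of "DG (F q) (w - w')"] have "(w - w') \<bullet> (w - w') = 0"
      using DF_DG[OF F_in[OF that]] by (simp add: GF[OF that] inner_diff_left)
    then show "w = w'" by simp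
  qed
  then have injA: "inj (?A q)" if "q \<in> U" for q
    using that by (intro injI) blast
  have smoothA: "smooth_on U (\<lambda>q. ?A q w)" for w
    by (intro smooth_on_sum smooth_on_bounded_linear[OF open_U bounded_linear_scaleR_left]
        smooth_on_bounded_linear[OF open_U bounded_linear_inner_left] open_U
        smooth_on_derivative smooth_F)
  let ?W = "\<lambda>q. rejection (map (?A q) ws) x"
  have "smooth_on U ?W"
    using B(2) ws by (intro smooth_on_rejection smooth_on_const open_U smoothA linA injA) auto
  moreover have "?W q = tangent_ext M x q" if q: "q \<in> M \<inter> U" for q
    unfolding tangent_ext_def
  proof (rule orth_proj_eqI[symmetric])
    show "subspace (tangent_space M q)" using q by (simp add: subspace_tangent)
    have span: "span (set (map (?A q) ws)) = ?A q ` L'"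
      using ws B(3) by (simp add: span_linear_image[OF linA])
    have "?W q \<bullet> ?A q w = 0" if "w \<in> L'" for w
    proof -
      have "orthogonal (?W q) (?A q w)"
      proof (rule orthogonal_to_span)
        show "?A q w \<in> span (set (map (?A q) ws))" using that span by blast
        show "orthogonal (?W q) n" if "n \<in> set (map (?A q) ws)" for n
          using rejection_orthogonal[OF that] by (simp add: orthogonal_def)
      qed
      then show ?thesis by (simp add: orthogonal_def)
    qed
    then have "DF q (?W q) \<bullet> w = 0" if "w \<in> L'" for w
      using A[of q w "?W q"] q that by (simp add: inner_commute)
    then have "DF q (?W q) \<in> L"
      unfolding L'_def by (subst subspace_mem_iff_orthogonal[OF subspace_L]) simp
    then show "?W q \<in> tangent_space M q"
      using q by (simp add: tangent_space_eq)
    fix v assume "v \<in> tangent_space M q"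
    then have v: "DF q v \<in> L" using q by (simp add: tangent_space_eq)
    obtain w where "w \<in> L'" "x - ?W q = ?A q w"
      using rejection_span[of x "map (?A q) ws"] span by auto
    then show "(x - ?W q) \<bullet> v = 0"
      using A[of q w v] q v by (auto simp: L'_def inner_commute)
  qed
  ultimately show ?thesis by blast
qed

end

section \<open>Calculus on a submanifold\<close>

text \<open>
  For \<open>i\<close> in the standard basis of the ambient space these derivations replace the derivatives along a
  local orthonormal frame. They are defined on all of \<open>M\<close> and involve no choice of a frame.
\<close>

definition tder :: "'a::euclidean_space set \<Rightarrow> 'a \<Rightarrow> ('a \<Rightarrow> 'b::real_normed_vector) \<Rightarrow> 'a \<Rightarrow> 'b" where
  "tder M i f q = differential M f q (tangent_ext M i q)"

lemma tder_cong: "q \<in> M \<Longrightarrow> (\<And>x. x \<in> M \<Longrightarrow> f x = g x) \<Longrightarrow> tder M i f q = tder M i g q"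
  unfolding tder_def by (rule differential_cong_on)

locale submanifold =
  fixes m :: nat and M :: "'a::euclidean_space set"
  assumes submanifold: "smooth_submanifold m M"
begin

lemma chartE:
  assumes "p \<in> M"
  obtains U V L F G where "submanifold_chart M U V L F G" "p \<in> U" "dim L = m"
  using submanifold assms unfolding smooth_submanifold_def submanifold_chart_def by metis

lemma subspace_tangent: "p \<in> M \<Longrightarrow> subspace (tangent_space M p)"
  by (meson chartE submanifold_chart.subspace_tangent)

lemma dim_tangent: "p \<in> M \<Longrightarrow> dim (tangent_space M p) = m"
  by (metis chartE submanifold_chart.dim_tangent)

lemma smooth_tangent_ext: "smooth_map_on M (tangent_ext M w)"
proof (rule smooth_map_onI)
  fix p assume "p \<in> M"
  then obtain U V L F G where "submanifold_chart M U V L F G" "p \<in> U" by (rule chartE)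
  then show "\<exists>U F. open U \<and> p \<in> U \<and> smooth_on U F \<and> (\<forall>x\<in>M \<inter> U. F x = tangent_ext M w x)"
    using submanifold_chart.smooth_tangent_ext_local[of M U V L F G w]
      submanifold_chart.open_U[of M U V L F G] by blast
qed

lemma tangent_ext_in: "p \<in> M \<Longrightarrow> tangent_ext M w p \<in> tangent_space M p"
  unfolding tangent_ext_def by (rule orth_proj_in[OF subspace_tangent])

lemma tangent_ext_self: "p \<in> M \<Longrightarrow> w \<in> tangent_space M p \<Longrightarrow> tangent_ext M w p = w"
  unfolding tangent_ext_def by (rule orth_proj_self[OF subspace_tangent])

lemma smooth_tder: "smooth_map_on M f \<Longrightarrow> smooth_map_on M (tder M i f)"
  unfolding tder_def[abs_def] by (intro smooth_map_on_differential smooth_tangent_ext tangent_ext_in)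

text \<open>
  Write \<open>P\<^sub>q\<close> for the projection onto the tangent space. Differentiating \<open>P\<^sub>q w \<bullet> P\<^sub>q z = P\<^sub>q w \<bullet> z\<close> gives
  \<open>w \<bullet> \<nabla>\<^sub>v(P z) = 0\<close> for tangent \<open>w\<close> and \<open>z\<close>. So the extension by projection is parallel at \<open>p\<close>, and
  all the correction terms in second covariant derivatives vanish.
\<close>

lemma orth_proj_derivative_tangent_ext:
  assumes p: "p \<in> M" and v: "v \<in> tangent_space M p" and "w \<in> tangent_space M p"
  shows "orth_proj (tangent_space M p) (differential M (tangent_ext M w) p v) = 0"
proof (rule orth_proj_eq_0[OF subspace_tangent[OF p]])
  fix z assume z: "z \<in> tangent_space M p"
  have "differential M (\<lambda>q. tangent_ext M z q \<bullet> tangent_ext M w q) p v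
      = differential M (\<lambda>q. tangent_ext M z q \<bullet> w) p v"
    using subspace_tangent unfolding tangent_ext_def
    by (intro differential_cong_on p) (metis orth_proj_in orth_proj_inner inner_commute)
  moreover have "differential M (\<lambda>q. tangent_ext M z q \<bullet> w) p v = differential M (tangent_ext M z) p v \<bullet> w"
    by (rule differential_bounded_linear[OF p v bounded_linear_inner_left smooth_tangent_ext])
  ultimately show "differential M (tangent_ext M w) p v \<bullet> z = 0"
    using assms z
    by (simp add: differential_inner[OF p v] smooth_tangent_ext tangent_ext_self inner_commute)
qed

lemma levi_civita_tangent_ext:
  assumes "p \<in> M" "v \<in> tangent_space M p" "w \<in> tangent_space M p"
  shows "levi_civita M (tangent_ext M w) p v = 0"
  using orth_proj_derivative_tangent_ext[OF assms] by (simp add: levi_civita_def pullback_conn_def)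

text \<open>
  In a chart \<open>F\<close>, the field \<open>DF q (P\<^sub>q w)\<close> stays in the model space \<open>L\<close>; hence so does its derivative,
  whose part involving second derivatives of \<open>F\<close> is symmetric. So the two sides differ by a tangent
  vector, and they have no tangential part.
\<close>

lemma derivative_tangent_ext_symmetric:
  assumes p: "p \<in> M" and v: "v \<in> tangent_space M p" and w: "w \<in> tangent_space M p"
  shows "differential M (tangent_ext M w) p v = differential M (tangent_ext M v) p w"
proof -
  let ?T = "tangent_space M p"
  obtain U V L F G where chart: "submanifold_chart M U V L F G" and pU: "p \<in> U"
    using p by (rule chartE)
  interpret submanifold_chart M U V L F G by fact
  have *: "frechet_derivative (\<lambda>x. DF x w) (at p) v + DF p (differential M (tangent_ext M w) p v) \<in> L"
    if v: "v \<in> ?T" and w: "w \<in> ?T" for v w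
  proof -
    obtain W where W: "smooth_on U W" "\<forall>q\<in>M \<inter> U. W q = tangent_ext M w q"
      using smooth_tangent_ext_local by blast
    let ?g = "\<lambda>q. DF q (W q)"
    have "smooth_on U ?g"
      by (rule smooth_on_derivative_field[OF open_U smooth_F W(1)])
    from has_derivative_at_withinI[OF smooth_on_has_derivative[OF open_U this pU]]
    have "(?g has_derivative frechet_derivative ?g (at p)) (at p within M)" .
    moreover have "\<forall>q\<in>M \<inter> U. ?g q \<in> L"
    proof
      fix q assume q: "q \<in> M \<inter> U"
      then have "W q \<in> tangent_space M q"
        using W(2) tangent_ext_in[of q w] by simp
      then show "?g q \<in> L" using q tangent_space_eq by blast
    qed
    ultimately have "frechet_derivative ?g (at p) v \<in> L"
      using derivative_in_subspace[OF _ p v open_U pU _ subspace_L] by blast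
    moreover have "W p = w" using W(2) p pU w by (simp add: tangent_ext_self)
    ultimately show ?thesis
      using derivative_of_directional_derivative[OF open_U smooth_F W(1) pU, of v]
        differential_local[OF open_U W(1) pU p W(2) v] by simp
  qed
  let ?d = "differential M (tangent_ext M w) p v - differential M (tangent_ext M v) p w"
  have "DF p ?d \<in> L"
    using subspace_diff[OF subspace_L *[OF v w] *[OF w v]]
      second_derivative_symmetric[OF smooth_F open_U pU, of v w]
    by (simp add: linear_diff[OF linear_DF[OF pU]])
  then have "?d \<in> ?T"
    using p pU by (simp add: tangent_space_eq)
  then have "?d = orth_proj ?T ?d"
    by (simp add: orth_proj_self[OF submanifold.subspace_tangent[OF submanifold_axioms p]])
  also have "\<dots> = 0"
    using orth_proj_derivative_tangent_ext[OF p] v w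
    by (simp add: linear_diff[OF orth_proj_linear[OF submanifold.subspace_tangent[OF submanifold_axioms p]]])
  finally show ?thesis by simp
qed

text \<open>
  For a local extension \<open>F\<close> of \<open>f\<close> both sides are a second derivative of \<open>F\<close> plus \<open>DF\<close> applied to a
  derivative of the projection, and both of these parts are symmetric.
\<close>

lemma hessian_symmetric:
  fixes f :: "'a \<Rightarrow> 'b::euclidean_space"
  assumes f: "smooth_map_on M f"
    and p: "p \<in> M" and v: "v \<in> tangent_space M p" and w: "w \<in> tangent_space M p"
  shows "differential M (\<lambda>q. differential M f q (tangent_ext M w q)) p v =
    differential M (\<lambda>q. differential M f q (tangent_ext M v q)) p w"
proof -
  obtain U F where F: "open U" "p \<in> U" "smooth_on U F" "\<forall>x\<in>M \<inter> U. F x = f x"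
    by (rule smooth_map_on_localE[OF f p])
  have *: "differential M (\<lambda>q. differential M f q (tangent_ext M w q)) p v =
      frechet_derivative (\<lambda>x. frechet_derivative F (at x) w) (at p) v +
      frechet_derivative F (at p) (differential M (tangent_ext M w) p v)"
    if v: "v \<in> tangent_space M p" and w: "w \<in> tangent_space M p" for v w
  proof -
    obtain U' W where W: "open U'" "p \<in> U'" "smooth_on U' W" "\<forall>x\<in>M \<inter> U'. W x = tangent_ext M w x"
      by (rule smooth_map_on_localE[OF smooth_tangent_ext p])
    define S where "S = U \<inter> U'"
    have S: "open S" "p \<in> S" "smooth_on S F" "smooth_on S W"
      using F W by (auto simp: S_def intro: smooth_on_subset)
    have "\<forall>x\<in>M \<inter> S. frechet_derivative F (at x) (W x) = differential M f x (tangent_ext M w x)"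
    proof
      fix x assume x: "x \<in> M \<inter> S"
      then have "differential M f x (tangent_ext M w x) = frechet_derivative F (at x) (tangent_ext M w x)"
        by (intro differential_local[OF F(1,3) _ _ F(4)] tangent_ext_in) (auto simp: S_def)
      then show "frechet_derivative F (at x) (W x) = differential M f x (tangent_ext M w x)"
        using W(4) x by (simp add: S_def)
    qed
    then have "differential M (\<lambda>q. differential M f q (tangent_ext M w q)) p v =
        frechet_derivative (\<lambda>q. frechet_derivative F (at q) (W q)) (at p) v"
      by (rule differential_local[OF S(1) smooth_on_derivative_field[OF S(1,3,4)] S(2) p _ v])
    also have "\<dots> = frechet_derivative (\<lambda>x. frechet_derivative F (at x) (W p)) (at p) v +
        frechet_derivative F (at p) (frechet_derivative W (at p) v)"
      by (rule derivative_of_directional_derivative[OF S(1,3,4,2)])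
    also have "W p = w" using W(2,4) p w by (simp add: tangent_ext_self)
    also have "frechet_derivative W (at p) v = differential M (tangent_ext M w) p v"
      by (rule differential_local[OF W(1,3,2) p W(4) v, symmetric])
    finally show ?thesis .
  qed
  show ?thesis
    using *[OF v w] *[OF w v] derivative_tangent_ext_symmetric[OF p v w]
      second_derivative_symmetric[OF F(3,1,2), of v w] by simp
qed

lemma tangent_ext_expand:
  assumes "q \<in> M"
  shows "tangent_ext M w q = (\<Sum>i\<in>Basis. (w \<bullet> i) *\<^sub>R tangent_ext M i q)"
  unfolding tangent_ext_def by (rule linear_sum_Basis[OF orth_proj_linear[OF subspace_tangent[OF assms]]])

lemma differential_tangent_ext:
  assumes "smooth_map_on M f" "q \<in> M"
  shows "differential M f q (tangent_ext M w q) = (\<Sum>i\<in>Basis. (w \<bullet> i) *\<^sub>R tder M i f q)"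
  unfolding tder_def
  by (subst tangent_ext_expand[OF assms(2)])
    (simp add: linear_sum[OF differential_linear[OF assms]] linear_scale[OF differential_linear[OF assms]])

lemma differential_eq_tder:
  assumes "smooth_map_on M f" "q \<in> M" "v \<in> tangent_space M q"
  shows "differential M f q v = (\<Sum>i\<in>Basis. (v \<bullet> i) *\<^sub>R tder M i f q)"
  using differential_tangent_ext[OF assms(1,2), of v] assms by (simp add: tangent_ext_self)

text \<open>
  Expand \<open>df(P\<^sub>q w)\<close> as \<open>\<Sum>\<^sub>i (P\<^sub>q w \<bullet> i) D\<^sub>i f\<close>. Differentiating the coefficients contributes \<open>df\<close> of the tangential
  part of \<open>\<nabla>\<^sub>v(P w)\<close>, which is zero.
\<close>

lemma hessian_eq_tder:
  assumes f: "smooth_map_on M f"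
    and p: "p \<in> M" and v: "v \<in> tangent_space M p" and w: "w \<in> tangent_space M p"
  shows "differential M (\<lambda>q. differential M f q (tangent_ext M w q)) p v =
    (\<Sum>i\<in>Basis. (w \<bullet> i) *\<^sub>R differential M (tder M i f) p v)"
proof -
  have sm: "smooth_map_on M (\<lambda>q. tangent_ext M w q \<bullet> i)" for i
    by (rule smooth_map_on_bounded_linear[OF bounded_linear_inner_left smooth_tangent_ext])
  let ?z = "differential M (tangent_ext M w) p v"
  have "differential M (\<lambda>q. differential M f q (tangent_ext M w q)) p v =
      differential M (\<lambda>q. \<Sum>i\<in>Basis. (tangent_ext M w q \<bullet> i) *\<^sub>R tder M i f q) p v"
    by (intro differential_cong_on p differential_eq_tder f tangent_ext_in)
  also have "\<dots> = (\<Sum>i\<in>Basis. differential M (\<lambda>q. (tangent_ext M w q \<bullet> i) *\<^sub>R tder M i f q) p v)"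
    by (intro differential_sum p v smooth_map_on_bilinear[OF bounded_bilinear_scaleR] sm smooth_tder f)
  also have "\<dots> = (\<Sum>i\<in>Basis. (w \<bullet> i) *\<^sub>R differential M (tder M i f) p v + (?z \<bullet> i) *\<^sub>R tder M i f p)"
    by (simp add: differential_scaleR_field[OF p v sm smooth_tder[OF f]] tangent_ext_self p w
        differential_bounded_linear[OF p v bounded_linear_inner_left smooth_tangent_ext])
  also have "\<dots> = (\<Sum>i\<in>Basis. (w \<bullet> i) *\<^sub>R differential M (tder M i f) p v)
      + differential M f p (tangent_ext M ?z p)"
    by (simp add: sum.distrib differential_tangent_ext[OF f p])
  also have "tangent_ext M ?z p = 0"
    unfolding tangent_ext_def[of M ?z] by (rule orth_proj_derivative_tangent_ext[OF p v w])
  also have "differential M f p 0 = 0"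
    by (rule linear_0[OF differential_linear[OF f p]])
  finally show ?thesis by simp
qed

end

section \<open>Traces and the Laplacian\<close>

lemma orthonormal_basis_of_props:
  fixes S :: "'a::euclidean_space set"
  assumes "subspace S" "orthonormal_basis_of S B"
  shows "finite B" "B \<subseteq> S" "card B = dim S" "(\<Sum>e\<in>B. (x \<bullet> e) *\<^sub>R e) = orth_proj S x"
proof -
  have B: "pairwise orthogonal B" "\<forall>b\<in>B. norm b = 1" "span B = S"
    using assms(2) by (auto simp: orthonormal_basis_of_def)
  then have ind: "independent B"
    by (intro pairwise_orthogonal_independent) auto
  show fin: "finite B" using ind by (rule independent_imp_finite)
  show sub: "B \<subseteq> S" using B(3) span_superset by blast
  show "card B = dim S" using dim_span_eq_card_independent[OF ind] B(3) by simp
  let ?u = "\<Sum>e\<in>B. (x \<bullet> e) *\<^sub>R e"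
  have "(x - ?u) \<bullet> b = 0" if b: "b \<in> B" for b
  proof -
    have "?u \<bullet> b = (\<Sum>e\<in>B. if e = b then x \<bullet> b else 0)"
      unfolding inner_sum_left
    proof (rule sum.cong)
      fix e assume "e \<in> B"
      then show "(x \<bullet> e) *\<^sub>R e \<bullet> b = (if e = b then x \<bullet> b else 0)"
        using B(1,2) b by (auto simp: pairwise_def orthogonal_def dot_square_norm)
    qed simp
    then show ?thesis using fin b by (simp add: inner_diff_left)
  qed
  then have "(x - ?u) \<bullet> w = 0" if "w \<in> S" for w
    using orthogonal_to_span[of w B "x - ?u"] that B(3) by (auto simp: orthogonal_def)
  moreover have "?u \<in> S"
    using sub by (intro subspace_sum subspace_scale assms(1)) auto
  ultimately show "?u = orth_proj S x"
    using orth_proj_eqI[OF assms(1)] by metis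
qed

lemma trace_on_obtain:
  fixes S :: "'a::euclidean_space set"
  assumes "subspace S"
  obtains B where "orthonormal_basis_of S B"
    "\<forall>b :: 'a \<Rightarrow> 'a \<Rightarrow> 'b::real_normed_vector. trace_on S b = (\<Sum>e\<in>B. b e e)"
proof
  obtain B where "pairwise orthogonal B" "\<And>x. x \<in> B \<Longrightarrow> norm x = 1" "span B = S"
    using orthonormal_basis_subspace[OF assms] by metis
  then have "orthonormal_basis_of S B"
    by (simp add: orthonormal_basis_of_def)
  then show "orthonormal_basis_of S (SOME B. orthonormal_basis_of S B)"
    by (rule someI)
qed (simp add: trace_on_def)

lemma trace_on_cong:
  fixes S :: "'a::euclidean_space set" and b b' :: "'a \<Rightarrow> 'a \<Rightarrow> 'b::real_normed_vector"
  assumes "subspace S" "\<And>v. v \<in> S \<Longrightarrow> b v v = b' v v"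
  shows "trace_on S b = trace_on S b'"
proof -
  obtain B where B: "orthonormal_basis_of S B"
    "\<forall>b :: 'a \<Rightarrow> 'a \<Rightarrow> 'b. trace_on S b = (\<Sum>e\<in>B. b e e)"
    by (rule trace_on_obtain[OF assms(1)])
  then show ?thesis
    using orthonormal_basis_of_props(2)[OF assms(1) B(1)] assms(2)
    by (auto intro!: sum.cong)
qed

lemma trace_on_linear: "linear h \<Longrightarrow> trace_on S (\<lambda>v w. h (b v w)) = h (trace_on S b)"
  unfolding trace_on_def by (simp add: linear_sum)

lemma trace_on_inner:
  fixes S :: "'a::euclidean_space set"
  assumes "subspace S"
  shows "trace_on S (\<lambda>v w. (v \<bullet> w) *\<^sub>R x) = real (dim S) *\<^sub>R x"
proof -
  obtain B where B: "orthonormal_basis_of S B"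
    "\<forall>b :: 'a \<Rightarrow> 'a \<Rightarrow> 'b::real_normed_vector. trace_on S b = (\<Sum>e\<in>B. b e e)"
    by (rule trace_on_obtain[OF assms])
  have "(\<Sum>e\<in>B. (e \<bullet> e) *\<^sub>R x) = (\<Sum>e\<in>B. x)"
    using B(1) by (intro sum.cong) (auto simp: orthonormal_basis_of_def dot_square_norm)
  then show ?thesis
    using B(2)[rule_format] orthonormal_basis_of_props(3)[OF assms B(1)] by (simp add: sum_constant_scaleR)
qed

text \<open>
  This turns a trace into a sum over the standard basis of the ambient space, which no longer
  involves a choice of basis and hence depends smoothly on the point.
\<close>

lemma trace_on_expand:
  fixes S :: "'a::euclidean_space set"
  assumes "subspace S"
    and "\<And>v. v \<in> S \<Longrightarrow> b v v = (\<Sum>i\<in>Basis. (v \<bullet> i) *\<^sub>R c i v)"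
    and "\<And>i. linear (c i)"
  shows "trace_on S b = (\<Sum>i\<in>Basis. c i (orth_proj S i))"
proof -
  obtain B where B: "orthonormal_basis_of S B"
    "\<forall>b :: 'a \<Rightarrow> 'a \<Rightarrow> 'b::real_normed_vector. trace_on S b = (\<Sum>e\<in>B. b e e)"
    by (rule trace_on_obtain[OF assms(1)])
  have "trace_on S b = (\<Sum>e\<in>B. \<Sum>i\<in>Basis. (e \<bullet> i) *\<^sub>R c i e)"
    unfolding B(2)[rule_format] using orthonormal_basis_of_props(2)[OF assms(1) B(1)] assms(2)
    by (intro sum.cong) auto
  also have "\<dots> = (\<Sum>i\<in>Basis. \<Sum>e\<in>B. (e \<bullet> i) *\<^sub>R c i e)"
    by (rule sum.swap)
  also have "\<dots> = (\<Sum>i\<in>Basis. c i (\<Sum>e\<in>B. (i \<bullet> e) *\<^sub>R e))"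
    by (simp add: linear_sum[OF assms(3)] linear_scale[OF assms(3)] inner_commute)
  finally show ?thesis
    by (simp add: orthonormal_basis_of_props(4)[OF assms(1) B(1)])
qed

text \<open>
  The term \<open>df(\<nabla>\<^sub>v W)\<close> of the covariant Hessian is absent, since it vanishes for tangent \<open>v\<close> and \<open>w\<close> when
  \<open>W\<close> extends \<open>w\<close> by projection.
\<close>

definition hessian :: "'a::euclidean_space set \<Rightarrow> ('a \<Rightarrow> 'b::real_normed_vector) \<Rightarrow> 'a \<Rightarrow> 'a \<Rightarrow> 'a \<Rightarrow> 'b"
  where "hessian M f p v w = differential M (\<lambda>q. differential M f q (tangent_ext M w q)) p v"

context submanifold
begin

lemma smooth_hessian_field:
  "smooth_map_on M f \<Longrightarrow> smooth_map_on M (\<lambda>q. differential M f q (tangent_ext M w q))"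
  by (intro smooth_map_on_differential smooth_tangent_ext tangent_ext_in)

text \<open>
  This formula is what makes the Laplacian accessible: its right-hand side visibly preserves
  smoothness and consists of derivations, for which a product rule holds.
\<close>

lemma trace_hessian:
  assumes f: "smooth_map_on M f" and p: "p \<in> M"
  shows "trace_on (tangent_space M p) (hessian M f p) = (\<Sum>i\<in>Basis. tder M i (tder M i f) p)"
proof -
  have "trace_on (tangent_space M p) (hessian M f p)
      = (\<Sum>i\<in>Basis. differential M (tder M i f) p (orth_proj (tangent_space M p) i))"
    unfolding hessian_def
    by (intro trace_on_expand subspace_tangent p hessian_eq_tder f
        differential_linear smooth_tder)
  then show ?thesis by (simp add: tder_def[of M _ "tder M _ f"] tangent_ext_def)
qed

lemma laplacian_eq_trace:
  assumes f: "smooth_map_on M f" and p: "p \<in> M"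
  shows "laplacian M f p = - trace_on (tangent_space M p) (hessian M f p)"
  unfolding laplacian_def hessian_def Let_def
  by (intro arg_cong[where f=uminus] trace_on_cong subspace_tangent p)
    (simp add: levi_civita_tangent_ext p linear_0[OF differential_linear[OF f p]])

lemma laplacian_eq:
  assumes "smooth_map_on M f" "p \<in> M"
  shows "laplacian M f p = - (\<Sum>i\<in>Basis. tder M i (tder M i f) p)"
  using laplacian_eq_trace[OF assms] trace_hessian[OF assms] by simp

lemma smooth_laplacian: "smooth_map_on M f \<Longrightarrow> smooth_map_on M (laplacian M f)"
  by (rule smooth_map_on_cong[of M "\<lambda>p. - (\<Sum>i\<in>Basis. tder M i (tder M i f) p)"])
    (simp_all add: laplacian_eq smooth_map_on_minus smooth_map_on_sum smooth_tder)

lemma tder_bounded_linear: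
  assumes "bounded_linear h" "smooth_map_on M f" "p \<in> M"
  shows "tder M i (\<lambda>q. h (f q)) p = h (tder M i f p)"
  unfolding tder_def by (rule differential_bounded_linear[OF assms(3) tangent_ext_in[OF assms(3)] assms(1,2)])

lemma tder_add:
  assumes "smooth_map_on M f" "smooth_map_on M g" "p \<in> M"
  shows "tder M i (\<lambda>q. f q + g q) p = tder M i f p + tder M i g p"
  unfolding tder_def by (rule differential_add[OF assms(3) tangent_ext_in[OF assms(3)] assms(1,2)])

lemma tder_inner:
  assumes "smooth_map_on M f" "smooth_map_on M g" "p \<in> M"
  shows "tder M i (\<lambda>q. f q \<bullet> g q) p = f p \<bullet> tder M i g p + tder M i f p \<bullet> g p"
  unfolding tder_def by (rule differential_inner[OF assms(3) tangent_ext_in[OF assms(3)] assms(1,2)])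

lemma tder_const: "p \<in> M \<Longrightarrow> tder M i (\<lambda>q. c) p = 0"
  unfolding tder_def by (rule differential_const[OF tangent_ext_in])

lemma laplacian_cong:
  assumes "smooth_map_on M f" "p \<in> M" "\<And>q. q \<in> M \<Longrightarrow> f q = g q"
  shows "laplacian M f p = laplacian M g p"
proof -
  have "tder M i (tder M i f) p = tder M i (tder M i g) p" for i
    by (intro tder_cong assms(2,3))
  then show ?thesis
    using laplacian_eq[OF assms(1,2)] laplacian_eq[OF smooth_map_on_cong[OF assms(1,3)] assms(2)] by simp
qed

lemma laplacian_bounded_linear:
  assumes "bounded_linear h" "smooth_map_on M f" "p \<in> M"
  shows "laplacian M (\<lambda>q. h (f q)) p = h (laplacian M f p)"
proof -
  have "tder M i (tder M i (\<lambda>q. h (f q))) p = h (tder M i (tder M i f) p)" for i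
  proof -
    have "tder M i (tder M i (\<lambda>q. h (f q))) p = tder M i (\<lambda>q. h (tder M i f q)) p"
      by (rule tder_cong[OF assms(3)]) (rule tder_bounded_linear[OF assms(1,2)])
    also have "\<dots> = h (tder M i (tder M i f) p)"
      by (rule tder_bounded_linear[OF assms(1) smooth_tder[OF assms(2)] assms(3)])
    finally show ?thesis .
  qed
  then show ?thesis
    by (simp add: laplacian_eq assms(2,3) smooth_map_on_bounded_linear[OF assms(1,2)]
        linear_neg[OF bounded_linear.linear[OF assms(1)]] linear_sum[OF bounded_linear.linear[OF assms(1)]])
qed

lemma laplacian_add:
  assumes "smooth_map_on M f" "smooth_map_on M g" "p \<in> M"
  shows "laplacian M (\<lambda>q. f q + g q) p = laplacian M f p + laplacian M g p"
proof -
  have "tder M i (tder M i (\<lambda>q. f q + g q)) p = tder M i (tder M i f) p + tder M i (tder M i g) p" for i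
  proof -
    have "tder M i (tder M i (\<lambda>q. f q + g q)) p = tder M i (\<lambda>q. tder M i f q + tder M i g q) p"
      by (rule tder_cong[OF assms(3)]) (rule tder_add[OF assms(1,2)])
    also have "\<dots> = tder M i (tder M i f) p + tder M i (tder M i g) p"
      by (rule tder_add[OF smooth_tder[OF assms(1)] smooth_tder[OF assms(2)] assms(3)])
    finally show ?thesis .
  qed
  then show ?thesis
    by (simp add: laplacian_eq assms smooth_map_on_add sum.distrib)
qed

lemma laplacian_scaleR:
  "smooth_map_on M f \<Longrightarrow> p \<in> M \<Longrightarrow> laplacian M (\<lambda>q. c *\<^sub>R f q) p = c *\<^sub>R laplacian M f p"
  by (rule laplacian_bounded_linear[OF bounded_linear_scaleR_right])

lemma laplacian_diff:
  assumes "smooth_map_on M f" "smooth_map_on M g" "p \<in> M"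
  shows "laplacian M (\<lambda>q. f q - g q) p = laplacian M f p - laplacian M g p"
  using laplacian_add[OF assms(1) smooth_map_on_scaleR[OF assms(2), of "-1"] assms(3)]
    laplacian_scaleR[OF assms(2,3), of "-1"] by simp

lemma laplacian_const: "p \<in> M \<Longrightarrow> laplacian M (\<lambda>q. c) p = 0"
  using tder_cong[of p M "tder M i (\<lambda>q. c)" "\<lambda>q. 0" i for i]
  by (simp add: laplacian_eq smooth_map_on_const tder_const)

text \<open>
  The product rule for the divergence of \<open>f \<bullet> \<nabla>g\<close>. It is applied below to pairs with \<open>f \<bullet> \<nabla>g = 0\<close>, where
  it converts products of gradients into values of the Laplacian.
\<close>

lemma sum_tder_inner:
  fixes f g :: "'a \<Rightarrow> 'b::euclidean_space"
  assumes "smooth_map_on M f" "smooth_map_on M g" "p \<in> M"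
  shows "(\<Sum>i\<in>Basis. tder M i (\<lambda>q. f q \<bullet> tder M i g q) p)
    = (\<Sum>i\<in>Basis. tder M i f p \<bullet> tder M i g p) - f p \<bullet> laplacian M g p"
  by (simp add: tder_inner[OF assms(1) smooth_tder[OF assms(2)] assms(3)] laplacian_eq[OF assms(2,3)]
      sum.distrib inner_sum_right)

text \<open>
  Both sides are the trace of the projection onto the tangent space.
\<close>

lemma sum_inner_tangent_ext:
  assumes p: "p \<in> M"
  shows "(\<Sum>i\<in>Basis. tangent_ext M i p \<bullet> tangent_ext M i p) = real m"
proof -
  let ?T = "tangent_space M p"
  note T = subspace_tangent[OF p]
  have "(\<Sum>i\<in>Basis. orth_proj ?T i \<bullet> i) = trace_on ?T (\<lambda>v w. (v \<bullet> w) *\<^sub>R 1)"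
    by (intro trace_on_expand[symmetric] T bounded_linear.linear[OF bounded_linear_inner_left])
      (simp add: euclidean_inner[of v v for v] power2_eq_square)
  also have "\<dots> = real m"
    using trace_on_inner[OF T, of "1::real"] by (simp add: dim_tangent p)
  moreover have "tangent_ext M i p \<bullet> tangent_ext M i p = orth_proj ?T i \<bullet> i" for i
    using orth_proj_inner[OF T orth_proj_in[OF T]] by (metis inner_commute tangent_ext_def)
  ultimately show ?thesis by simp
qed

text \<open>
  A map with zero differential is locally constant: near \<open>p\<close> the points of \<open>M\<close> are joined to \<open>p\<close> by the images
  of segments in the model space of a chart.
\<close>

lemma constant_if_tder_eq_0:
  fixes f :: "'a \<Rightarrow> 'b::euclidean_space"
  assumes "connected M" and f: "smooth_map_on M f"
    and 0: "\<And>p i. p \<in> M \<Longrightarrow> i \<in> Basis \<Longrightarrow> tder M i f p = 0"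
    and "a \<in> M" "b \<in> M"
  shows "f a = f b"
proof (rule connected_local_const[OF assms(1,4,5)], intro ballI)
  fix p assume p: "p \<in> M"
  obtain U V L F G where "submanifold_chart M U V L F G" and pU: "p \<in> U"
    using p by (rule chartE)
  then interpret submanifold_chart M U V L F G by simp
  obtain r where r: "0 < r" "ball (F p) r \<subseteq> V"
    using F_in[OF pU] open_V openE by blast
  define N where "N = U \<inter> F -` ball (F p) r"
  have "open N"
    unfolding N_def by (rule continuous_open_preimage[OF smooth_on_imp_continuous_on[OF smooth_F] open_U]) simp
  moreover have "p \<in> N" using pU r by (simp add: N_def)
  moreover have "f p = f q" if q: "q \<in> M" "q \<in> N" for q
  proof -
    define a where "a = F q - F p"
    let ?c = "\<lambda>t. F p + t *\<^sub>R a"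
    have FL: "F p \<in> L" "F q \<in> L" using p q pU F_in_L by (auto simp: N_def)
    then have aL: "a \<in> L" by (simp add: a_def subspace_diff subspace_L)
    have c: "?c t \<in> L" "?c t \<in> V" if "t \<in> {0..1}" for t
    proof -
      show "?c t \<in> L" using FL aL by (simp add: subspace_add subspace_scale subspace_L)
      have "?c t = (1 - t) *\<^sub>R F p + t *\<^sub>R F q" by (simp add: a_def algebra_simps)
      moreover have "F p \<in> ball (F p) r" "F q \<in> ball (F p) r" using r q by (auto simp: N_def)
      ultimately have "?c t \<in> ball (F p) r"
        using convexD_alt[OF convex_ball, of "F p" "F p" r "F q" t] that by simp
      then show "?c t \<in> V" using r by blast
    qed
    have "((\<lambda>t. f (G (?c t))) has_derivative (\<lambda>s. 0)) (at t within {0..1})" if t: "t \<in> {0..1}" for t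
    proof -
      let ?D = "differential M f (G (?c t))"
      have G: "((\<lambda>t. G (?c t)) has_derivative (\<lambda>s. s *\<^sub>R DG (?c t) a)) (at t within {0..1})"
        using line_derivative[OF c(2)[OF t]] unfolding has_vector_derivative_def
        by (rule has_derivative_at_withinI)
      have GM: "G (?c t) \<in> M" by (rule G_in_M[OF c[OF t]])
      have "(\<lambda>t. G (?c t)) ` {0..1} \<subseteq> M" using G_in_M c by blast
      then have "(f has_derivative ?D) (at (G (?c t)) within (\<lambda>t. G (?c t)) ` {0..1})"
        by (rule has_derivative_subset[OF smooth_map_on_has_derivative[OF f GM]])
      then have "((\<lambda>t. f (G (?c t))) has_derivative (\<lambda>s. ?D (s *\<^sub>R DG (?c t) a))) (at t within {0..1})"
        by (rule has_derivative_in_compose[where g=f, OF G])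
      moreover have "?D (DG (?c t) a) = 0"
        using differential_eq_tder[OF f GM tangent_of_line[OF c[OF t] aL]] 0[OF GM] by simp
      ultimately show ?thesis
        by (simp add: linear_scale[OF differential_linear[OF f GM]])
    qed
    then have "f (G (?c 1)) = f (G (?c 0))"
      by (rule has_derivative_zero_unique[OF convex_real_interval(5), of 0 1]) auto
    then show ?thesis
      using q pU by (simp add: a_def N_def GF)
  qed
  ultimately show "\<forall>\<^sub>F q in at p within M. f p = f q"
    unfolding eventually_at_topological by blast
qed

end

section \<open>The unit sphere\<close>

text \<open>
  The induction works because the derivative has the same form, with other vectors \<open>a\<close> and \<open>b\<close>.
\<close>

lemma smooth_on_circle: "smooth_on UNIV (\<lambda>t::real. cos (c * t) *\<^sub>R a + sin (c * t) *\<^sub>R (b::'a::euclidean_space))"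
proof -
  have "Ck_on k UNIV (\<lambda>t::real. cos (c * t) *\<^sub>R a + sin (c * t) *\<^sub>R b)" for k
  proof (induction k arbitrary: a b)
    case 0
    show ?case by (auto intro!: continuous_intros)
  next
    case (Suc k)
    show ?case
    proof (rule Ck_on_Suc_intro)
      show "((\<lambda>t. cos (c * t) *\<^sub>R a + sin (c * t) *\<^sub>R b) has_derivative
          (\<lambda>s. cos (c * t) *\<^sub>R ((s * c) *\<^sub>R b) + sin (c * t) *\<^sub>R ((- s * c) *\<^sub>R a))) (at t)" for t
        by (rule derivative_eq_intros refl)+ (simp add: algebra_simps)
      show "Ck_on k UNIV (\<lambda>t. cos (c * t) *\<^sub>R ((s * c) *\<^sub>R b) + sin (c * t) *\<^sub>R ((- s * c) *\<^sub>R a))" for s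
        by (rule Suc.IH)
    qed simp
  qed
  then show ?thesis unfolding smooth_on_def by blast
qed

lemma tangent_space_sphere:
  fixes y :: "'a::euclidean_space"
  assumes y: "y \<in> sphere 0 1"
  shows "tangent_space (sphere 0 1) y = {v. v \<bullet> y = 0}"
proof (intro set_eqI iffI)
  fix v assume v: "v \<in> tangent_space (sphere 0 1) y"
  have "((\<lambda>x. x \<bullet> x) has_derivative (\<lambda>v. y \<bullet> v + v \<bullet> y)) (at y within sphere 0 1)"
    by (auto intro!: derivative_eq_intros)
  from differential_eq[OF this v]
  have "differential (sphere 0 1) (\<lambda>x. x \<bullet> x) y v = 2 * (v \<bullet> y)"
    by (simp add: inner_commute)
  moreover have "differential (sphere 0 1) (\<lambda>x. x \<bullet> x) y v = differential (sphere 0 1) (\<lambda>x::'a. 1::real) y v"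
    by (rule differential_cong_on[OF y]) (simp add: dot_square_norm)
  ultimately show "v \<in> {v. v \<bullet> y = 0}"
    using v by (simp add: differential_const)
next
  fix v assume "v \<in> {v. v \<bullet> y = 0}"
  then have v: "v \<bullet> y = 0" "y \<bullet> v = 0" by (simp_all add: inner_commute)
  have yy: "y \<bullet> y = 1" using y by (simp add: dot_square_norm)
  \<comment> \<open>The great circle through \<open>y\<close> with velocity \<open>v\<close>; it is constant for \<open>v = 0\<close>, where \<open>?u = 0\<close>.\<close>
  let ?c = "norm v" and ?u = "v /\<^sub>R norm v"
  let ?\<gamma> = "\<lambda>t::real. cos (?c * t) *\<^sub>R y + sin (?c * t) *\<^sub>R ?u"
  have "?\<gamma> t \<in> sphere 0 1" for t
  proof (cases "v = 0")
    case False
    have "?u \<bullet> ?u = 1" using False by (simp add: dot_square_norm power2_eq_square)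
    moreover have "?\<gamma> t \<bullet> ?\<gamma> t = (cos (?c * t))\<^sup>2 * (y \<bullet> y) + (sin (?c * t))\<^sup>2 * (?u \<bullet> ?u)
        + 2 * cos (?c * t) * sin (?c * t) * inverse (norm v) * (v \<bullet> y)"
      by (simp only: inner_add_left inner_add_right inner_scaleR_left inner_scaleR_right
          inner_commute[of y v] power2_eq_square) (simp only: algebra_simps)
    ultimately have "?\<gamma> t \<bullet> ?\<gamma> t = 1"
      using v yy by simp
    then show ?thesis by (simp add: norm_eq_1)
  qed (use y in simp)
  moreover have "(?\<gamma> has_vector_derivative v) (at 0)"
  proof -
    have "(?\<gamma> has_derivative (\<lambda>s. s *\<^sub>R (?c *\<^sub>R ?u))) (at 0)"
      by (rule derivative_eq_intros refl)+ (simp add: mult_ac)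
    moreover have "?c *\<^sub>R ?u = v" by (cases "v = 0") simp_all
    ultimately show ?thesis unfolding has_vector_derivative_def by metis
  qed
  ultimately show "v \<in> tangent_space (sphere 0 1) y"
    unfolding tangent_space_def
    by (intro CollectI exI[of _ ?\<gamma>] exI[of _ 1] conjI smooth_on_subset[OF smooth_on_circle]) auto
qed

lemma subspace_tangent_sphere:
  "y \<in> sphere 0 1 \<Longrightarrow> subspace (tangent_space (sphere 0 1) (y::'a::euclidean_space))"
  by (simp add: tangent_space_sphere subspace_def inner_add_left)

lemma orth_proj_sphere:
  fixes y :: "'a::euclidean_space"
  assumes y: "y \<in> sphere 0 1"
  shows "orth_proj (tangent_space (sphere 0 1) y) x = x - (x \<bullet> y) *\<^sub>R y"
  by (rule orth_proj_eqI[OF subspace_tangent_sphere[OF y]])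
    (use y in \<open>auto simp: tangent_space_sphere inner_diff_left dot_square_norm inner_commute[of y]\<close>)

lemma levi_civita_sphere:
  fixes q :: "'a::euclidean_space"
  assumes q: "q \<in> sphere 0 1" and v: "v \<bullet> q = 0"
  shows "differential (sphere 0 1) (tangent_ext (sphere 0 1) w) q v = - (w \<bullet> q) *\<^sub>R v - (w \<bullet> v) *\<^sub>R q"
    and "levi_civita (sphere 0 1) (tangent_ext (sphere 0 1) w) q v = - (w \<bullet> q) *\<^sub>R v"
proof -
  let ?S = "sphere 0 1 :: 'a set"
  have qq: "q \<bullet> q = 1" using q by (simp add: dot_square_norm)
  have vT: "v \<in> tangent_space ?S q" using v q by (simp add: tangent_space_sphere)
  have "((\<lambda>q. w - (w \<bullet> q) *\<^sub>R q) has_derivative (\<lambda>v. - (w \<bullet> q) *\<^sub>R v - (w \<bullet> v) *\<^sub>R q)) (at q within ?S)"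
    by (rule derivative_eq_intros refl)+ simp
  from differential_eq[OF this vT]
  show *: "differential ?S (tangent_ext ?S w) q v = - (w \<bullet> q) *\<^sub>R v - (w \<bullet> v) *\<^sub>R q"
    using differential_cong_on[OF q, of "tangent_ext ?S w" "\<lambda>q. w - (w \<bullet> q) *\<^sub>R q" v]
    by (simp add: tangent_ext_def orth_proj_sphere)
  show "levi_civita ?S (tangent_ext ?S w) q v = - (w \<bullet> q) *\<^sub>R v"
    using q v qq by (simp add: levi_civita_def pullback_conn_def * orth_proj_sphere inner_diff_left)
qed

text \<open>
  The extensions by projection commute at \<open>y\<close>, and \<open>\<nabla>\<^sub>Y Z = - (w \<bullet> q) Y\<close> near \<open>y\<close> with \<open>Y\<close> parallel at \<open>y\<close>, so
  only the derivative of the coefficient \<open>- (w \<bullet> q)\<close> survives.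
\<close>

lemma curvature_sphere:
  fixes y :: "'a::euclidean_space"
  assumes y: "y \<in> sphere 0 1" and "u \<bullet> y = 0" "v \<bullet> y = 0" "w \<bullet> y = 0"
  shows "curvature (sphere 0 1) y u v w = (v \<bullet> w) *\<^sub>R u - (u \<bullet> w) *\<^sub>R v"
proof -
  let ?S = "sphere 0 1 :: 'a set"
  have yy: "y \<bullet> y = 1" using y by (simp add: dot_square_norm)
  let ?P = "tangent_ext ?S"
  have P: "?P x q = x - (x \<bullet> q) *\<^sub>R q" "?P x q \<bullet> q = 0" if "q \<in> ?S" for x q
    using that by (simp_all add: tangent_ext_def orth_proj_sphere inner_diff_left dot_square_norm)
  have Py: "?P x y = x" if "x \<bullet> y = 0" for x
    using P(1)[OF y] that by simp
  have second: "levi_civita ?S (\<lambda>q. levi_civita ?S (?P w) q (?P v q)) y u = - (w \<bullet> u) *\<^sub>R v"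
    if u: "u \<bullet> y = 0" and v: "v \<bullet> y = 0" for u v
  proof -
    have uT: "u \<in> tangent_space ?S y" using u y by (simp add: tangent_space_sphere)
    have "((\<lambda>q. - (w \<bullet> q) *\<^sub>R (v - (v \<bullet> q) *\<^sub>R q)) has_derivative
        (\<lambda>u. - (w \<bullet> u) *\<^sub>R (v - (v \<bullet> y) *\<^sub>R y) - (w \<bullet> y) *\<^sub>R (- (v \<bullet> u) *\<^sub>R y - (v \<bullet> y) *\<^sub>R u))) (at y within ?S)"
      by (rule derivative_eq_intros refl)+ (simp add: algebra_simps)
    from differential_eq[OF this uT]
    have "differential ?S (\<lambda>q. - (w \<bullet> q) *\<^sub>R (v - (v \<bullet> q) *\<^sub>R q)) y u = - (w \<bullet> u) *\<^sub>R v"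
      using assms(4) v by simp
    moreover have "differential ?S (\<lambda>q. levi_civita ?S (?P w) q (?P v q)) y u =
        differential ?S (\<lambda>q. - (w \<bullet> q) *\<^sub>R (v - (v \<bullet> q) *\<^sub>R q)) y u"
    proof (rule differential_cong_on[OF y])
      fix q assume q: "q \<in> ?S"
      show "levi_civita ?S (?P w) q (?P v q) = - (w \<bullet> q) *\<^sub>R (v - (v \<bullet> q) *\<^sub>R q)"
        using levi_civita_sphere(2)[OF q P(2)[OF q], of w v] P(1)[OF q, of v] by simp
    qed
    ultimately have "differential ?S (\<lambda>q. levi_civita ?S (?P w) q (?P v q)) y u = - (w \<bullet> u) *\<^sub>R v"
      by (rule trans[rotated])
    then show ?thesis
      using v y by (subst levi_civita_def) (simp add: pullback_conn_def orth_proj_sphere)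
  qed
  have "lie_bracket ?S (?P u) (?P v) y = 0"
    using assms by (simp add: lie_bracket_def levi_civita_sphere(1)[OF y] Py inner_commute)
  then show ?thesis
    using assms by (simp add: curvature_def Let_def second levi_civita_sphere(2)[OF y] Py inner_commute)
qed

section \<open>Isometric immersions into the unit sphere\<close>

locale spherical_immersion = submanifold m M for m and M :: "'b::euclidean_space set" +
  fixes \<phi> :: "'b \<Rightarrow> 'a::euclidean_space"
  assumes isometric: "isometric_immersion M (sphere 0 1) \<phi>"
begin

abbreviation "\<tau> \<equiv> tension_field M (sphere 0 1) \<phi>"
abbreviation "\<Delta> \<equiv> laplacian M"

lemma smooth_phi: "smooth_map_on M \<phi>"
  using isometric by (simp add: isometric_immersion_def)

lemma phi_in_sphere: "p \<in> M \<Longrightarrow> \<phi> p \<in> sphere 0 1"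
  using isometric by (auto simp: isometric_immersion_def)

lemma phi_inner_phi: "p \<in> M \<Longrightarrow> \<phi> p \<bullet> \<phi> p = 1"
  using phi_in_sphere by (simp add: dot_square_norm)

lemma orth_proj_phi:
  "p \<in> M \<Longrightarrow> orth_proj (tangent_space (sphere 0 1) (\<phi> p)) x = x - (x \<bullet> \<phi> p) *\<^sub>R \<phi> p"
  by (rule orth_proj_sphere[OF phi_in_sphere])

lemma differential_isometric:
  "p \<in> M \<Longrightarrow> v \<in> tangent_space M p \<Longrightarrow> w \<in> tangent_space M p \<Longrightarrow>
    differential M \<phi> p v \<bullet> differential M \<phi> p w = v \<bullet> w"
  using isometric by (auto simp: isometric_immersion_def)

lemma phi_orthogonal:
  assumes p: "p \<in> M" and v: "v \<in> tangent_space M p"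
  shows "\<phi> p \<bullet> differential M \<phi> p v = 0"
proof -
  have "differential M (\<lambda>q. \<phi> q \<bullet> \<phi> q) p v = differential M (\<lambda>q. 1::real) p v"
    by (rule differential_cong_on[OF p]) (rule phi_inner_phi)
  then show ?thesis
    by (simp add: differential_inner[OF p v smooth_phi smooth_phi] differential_const[OF v] inner_commute)
qed

lemma sum_tder_phi:
  assumes p: "p \<in> M"
  shows "(\<Sum>i\<in>Basis. tder M i \<phi> p \<bullet> tder M i \<phi> p) = real m"
  using sum_inner_tangent_ext[OF p] by (simp add: tder_def differential_isometric p tangent_ext_in)

text \<open>
  The divergence of \<open>\<phi> \<bullet> \<nabla>\<phi> = 0\<close> is \<open>|d\<phi>|\<^sup>2 - \<phi> \<bullet> \<Delta>\<phi>\<close>, and \<open>|d\<phi>|\<^sup>2 = m\<close> by isometry.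
\<close>

lemma phi_laplacian:
  assumes p: "p \<in> M"
  shows "\<phi> p \<bullet> \<Delta> \<phi> p = real m"
proof -
  have "tder M i (\<lambda>q. \<phi> q \<bullet> tder M i \<phi> q) p = tder M i (\<lambda>q. 0::real) p" for i
    by (rule tder_cong[OF p]) (simp add: tder_def phi_orthogonal tangent_ext_in)
  then show ?thesis
    using sum_tder_inner[OF smooth_phi smooth_phi p] sum_tder_phi[OF p] by (simp add: tder_const p)
qed

text \<open>
  The Koszul argument: by isometry \<open>(v, w, z) \<mapsto> hessian v w \<bullet> d\<phi> z\<close> is skew in the last two
  arguments, and it is symmetric in the first two, so it is zero.
\<close>

lemma hessian_normal:
  assumes p: "p \<in> M" and "v \<in> tangent_space M p" "w \<in> tangent_space M p" "z \<in> tangent_space M p"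
  shows "hessian M \<phi> p v w \<bullet> differential M \<phi> p z = 0"
proof -
  let ?T = "tangent_space M p"
  let ?a = "\<lambda>v w z. hessian M \<phi> p v w \<bullet> differential M \<phi> p z"
  have skew: "?a v w z = - ?a v z w" if v: "v \<in> ?T" and w: "w \<in> ?T" and z: "z \<in> ?T" for v w z
  proof -
    let ?X = "\<lambda>w q. differential M \<phi> q (tangent_ext M w q)"
    have "differential M (\<lambda>q. ?X w q \<bullet> ?X z q) p v
        = differential M (\<lambda>q. tangent_ext M w q \<bullet> tangent_ext M z q) p v"
      by (rule differential_cong_on[OF p]) (simp add: differential_isometric tangent_ext_in)
    moreover have "differential M (\<lambda>q. ?X w q \<bullet> ?X z q) p v = ?a v w z + ?a v z w"
      unfolding differential_inner[OF p v smooth_hessian_field[OF smooth_phi] smooth_hessian_field[OF smooth_phi]]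
      using w z by (simp add: tangent_ext_self p hessian_def inner_commute)
    moreover have "differential M (\<lambda>q. tangent_ext M w q \<bullet> tangent_ext M z q) p v = 0"
    proof -
      have "differential M (tangent_ext M w) p v \<bullet> z = 0" if "w \<in> ?T" "z \<in> ?T" for w z
        using orth_proj_inner[OF subspace_tangent[OF p] that(2), of "differential M (tangent_ext M w) p v"]
          orth_proj_derivative_tangent_ext[OF p v that(1)] by simp
      then show ?thesis
        unfolding differential_inner[OF p v smooth_tangent_ext smooth_tangent_ext]
        using w z by (simp add: tangent_ext_self p inner_commute)
    qed
    ultimately show ?thesis by simp
  qed
  have sym: "?a v w z = ?a w v z" if "v \<in> ?T" "w \<in> ?T" for v w z
    using hessian_symmetric[OF smooth_phi p that] by (simp add: hessian_def)
  show ?thesis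
    using skew[of v w z] sym[of v z w] skew[of z v w] sym[of z w v] skew[of w z v] sym[of w v z] assms
    by simp
qed

text \<open>
  The trace of the Euclidean Hessian is \<open>- \<Delta>\<phi>\<close>; its radial part, which the projection to the sphere
  removes, is \<open>- m \<phi>\<close> by \<open>phi_laplacian\<close>.
\<close>

lemma tension_field_eq:
  assumes p: "p \<in> M"
  shows "\<tau> p = real m *\<^sub>R \<phi> p - \<Delta> \<phi> p"
proof -
  let ?T = "tangent_space M p" and ?h = "\<lambda>x. x - (x \<bullet> \<phi> p) *\<^sub>R \<phi> p"
  have "linear ?h"
    by (rule linearI) (simp_all add: algebra_simps)
  have "\<tau> p = trace_on ?T (\<lambda>v w. ?h (hessian M \<phi> p v w))"
    unfolding tension_field_def
    by (intro trace_on_cong subspace_tangent p)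
      (simp add: second_fundamental_form_map_def Let_def hessian_def pullback_conn_def orth_proj_phi p
        levi_civita_tangent_ext linear_0[OF differential_linear[OF smooth_phi p]])
  also have "\<dots> = ?h (trace_on ?T (hessian M \<phi> p))"
    by (rule trace_on_linear[OF \<open>linear ?h\<close>])
  also have "trace_on ?T (hessian M \<phi> p) = - \<Delta> \<phi> p"
    by (simp add: laplacian_eq_trace smooth_phi p)
  finally show ?thesis
    using phi_laplacian[OF p] by (simp add: inner_commute)
qed

lemma tension_normal:
  assumes p: "p \<in> M" and z: "z \<in> tangent_space M p"
  shows "\<tau> p \<bullet> differential M \<phi> p z = 0"
proof -
  let ?T = "tangent_space M p"
  have "trace_on ?T (hessian M \<phi> p) \<bullet> differential M \<phi> p z
      = trace_on ?T (\<lambda>v w. hessian M \<phi> p v w \<bullet> differential M \<phi> p z)"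
    by (rule trace_on_linear[OF bounded_linear.linear[OF bounded_linear_inner_left], symmetric])
  also have "\<dots> = trace_on ?T (\<lambda>v w. 0)"
    by (intro trace_on_cong subspace_tangent p) (simp add: hessian_normal p z)
  also have "\<dots> = 0" by (simp add: trace_on_def)
  finally show ?thesis
    using phi_orthogonal[OF p z]
    by (simp add: tension_field_eq p laplacian_eq_trace smooth_phi inner_add_left)
qed

text \<open>
  By \<open>hessian_normal\<close> the covariant derivative of \<open>d\<phi>\<close> is already normal to the immersed submanifold, so
  taking its normal part changes nothing.
\<close>

lemma mean_curvature_vector_eq:
  assumes p: "p \<in> M"
  shows "mean_curvature_vector m M (sphere 0 1) \<phi> p = (1 / real m) *\<^sub>R \<tau> p"
proof -
  let ?T = "tangent_space M p"
  have sub: "subspace (differential M \<phi> p ` ?T)"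
    by (rule linear_subspace_image[OF differential_linear[OF smooth_phi p] subspace_tangent[OF p]])
  have "second_fundamental_form M (sphere 0 1) \<phi> p v v = second_fundamental_form_map M (sphere 0 1) \<phi> p v v"
    if v: "v \<in> ?T" for v
  proof -
    let ?D = "pullback_conn M (sphere 0 1) \<phi> (\<lambda>q. differential M \<phi> q (tangent_ext M v q)) p v"
    have D: "?D = hessian M \<phi> p v v - (hessian M \<phi> p v v \<bullet> \<phi> p) *\<^sub>R \<phi> p"
      by (simp add: pullback_conn_def orth_proj_phi p hessian_def)
    have "orth_proj (differential M \<phi> p ` ?T) ?D = 0"
      by (rule orth_proj_eq_0[OF sub])
        (auto simp: D inner_diff_left hessian_normal phi_orthogonal p v)
    then show ?thesis
      by (simp add: second_fundamental_form_def second_fundamental_form_map_def Let_def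
        levi_civita_tangent_ext p v linear_0[OF differential_linear[OF smooth_phi p]])
  qed
  then have "trace_on ?T (second_fundamental_form M (sphere 0 1) \<phi> p) = \<tau> p"
    unfolding tension_field_def by (intro trace_on_cong subspace_tangent p)
  then show ?thesis by (simp add: mean_curvature_vector_def)
qed

lemma smooth_tension: "smooth_map_on M \<tau>"
  by (rule smooth_map_on_cong[of M "\<lambda>p. real m *\<^sub>R \<phi> p - \<Delta> \<phi> p"])
    (simp_all add: tension_field_eq smooth_map_on_diff smooth_map_on_scaleR smooth_phi smooth_laplacian)

lemma tension_phi: "p \<in> M \<Longrightarrow> \<phi> p \<bullet> \<tau> p = 0"
  by (simp add: tension_field_eq inner_diff_right phi_inner_phi phi_laplacian)

lemma tension_laplacian_phi: "p \<in> M \<Longrightarrow> \<tau> p \<bullet> \<Delta> \<phi> p = - (\<tau> p \<bullet> \<tau> p)"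
proof -
  assume p: "p \<in> M"
  have "\<Delta> \<phi> p = real m *\<^sub>R \<phi> p - \<tau> p" by (simp add: tension_field_eq p)
  then show ?thesis
    using tension_phi[OF p] by (simp add: inner_diff_right inner_commute)
qed

lemma differential_tension_phi:
  assumes p: "p \<in> M" and v: "v \<in> tangent_space M p"
  shows "differential M \<tau> p v \<bullet> \<phi> p = 0"
proof -
  have "differential M (\<lambda>q. \<phi> q \<bullet> \<tau> q) p v = differential M (\<lambda>q. 0::real) p v"
    by (rule differential_cong_on[OF p]) (rule tension_phi)
  then show ?thesis
    using tension_normal[OF p v]
    by (simp add: differential_inner[OF p v smooth_phi smooth_tension] differential_const[OF v] inner_commute)
qed

lemma sum_tder_phi_tension:
  assumes p: "p \<in> M"
  shows "(\<Sum>i\<in>Basis. tder M i \<phi> p \<bullet> tder M i \<tau> p) = - (\<tau> p \<bullet> \<tau> p)"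
proof -
  have "tder M i (\<lambda>q. \<tau> q \<bullet> tder M i \<phi> q) p = tder M i (\<lambda>q. 0::real) p" for i
    by (rule tder_cong[OF p]) (simp add: tder_def tension_normal tangent_ext_in)
  then have "(\<Sum>i\<in>Basis. tder M i \<tau> p \<bullet> tder M i \<phi> p) = \<tau> p \<bullet> \<Delta> \<phi> p"
    using sum_tder_inner[OF smooth_tension smooth_phi p] by (simp add: tder_const p)
  then show ?thesis
    using tension_laplacian_phi[OF p] by (simp add: inner_commute)
qed

lemma phi_laplacian_tension:
  assumes p: "p \<in> M"
  shows "\<phi> p \<bullet> \<Delta> \<tau> p = - (\<tau> p \<bullet> \<tau> p)"
proof -
  have "tder M i (\<lambda>q. \<phi> q \<bullet> tder M i \<tau> q) p = tder M i (\<lambda>q. 0::real) p" for i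
    by (rule tder_cong[OF p])
      (simp add: tder_def differential_tension_phi tangent_ext_in inner_commute[of "\<phi> _"])
  then show ?thesis
    using sum_tder_inner[OF smooth_phi smooth_tension p] sum_tder_phi_tension[OF p]
    by (simp add: tder_const p)
qed

text \<open>
  Since \<open>\<tau>\<close> is orthogonal to \<open>d\<phi>\<close>, its derivative has no radial part, and only the second of the two
  projections to the sphere in \<open>\<nabla>\<^sup>2\<tau>\<close> acts. It removes the radial part given by \<open>phi_laplacian_tension\<close>.
\<close>

lemma rough_laplacian_tension:
  assumes p: "p \<in> M"
  shows "rough_laplacian M (sphere 0 1) \<phi> \<tau> p = \<Delta> \<tau> p + (\<tau> p \<bullet> \<tau> p) *\<^sub>R \<phi> p"
proof -
  let ?T = "tangent_space M p" and ?h = "\<lambda>x. x - (x \<bullet> \<phi> p) *\<^sub>R \<phi> p"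
  have "linear ?h"
    by (rule linearI) (simp_all add: algebra_simps)
  have "second_cov_deriv M (sphere 0 1) \<phi> \<tau> p v v = ?h (hessian M \<tau> p v v)" if v: "v \<in> ?T" for v
  proof -
    have "differential M (\<lambda>q. pullback_conn M (sphere 0 1) \<phi> \<tau> q (tangent_ext M v q)) p v = hessian M \<tau> p v v"
      unfolding hessian_def
      by (rule differential_cong_on[OF p])
        (simp add: pullback_conn_def orth_proj_phi differential_tension_phi tangent_ext_in)
    then show ?thesis
      by (simp add: second_cov_deriv_def Let_def levi_civita_tangent_ext p v
          pullback_conn_def[of _ _ _ _ p] orth_proj_phi linear_0[OF differential_linear[OF smooth_tension p]])
  qed
  then have "trace_on ?T (second_cov_deriv M (sphere 0 1) \<phi> \<tau> p) = trace_on ?T (\<lambda>v w. ?h (hessian M \<tau> p v w))"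
    by (intro trace_on_cong subspace_tangent p)
  also have "\<dots> = ?h (trace_on ?T (hessian M \<tau> p))"
    by (rule trace_on_linear[OF \<open>linear ?h\<close>])
  also have "trace_on ?T (hessian M \<tau> p) = - \<Delta> \<tau> p"
    by (simp add: laplacian_eq_trace smooth_tension p)
  finally show ?thesis
    using phi_laplacian_tension[OF p] by (simp add: rough_laplacian_def inner_commute)
qed

lemma bitension_field_eq:
  assumes p: "p \<in> M"
  shows "bitension_field M (sphere 0 1) \<phi> p
    = real m *\<^sub>R \<tau> p - \<Delta> \<tau> p - (\<tau> p \<bullet> \<tau> p) *\<^sub>R \<phi> p"
proof -
  let ?T = "tangent_space M p"
  have "trace_on ?T (\<lambda>v w. curvature (sphere 0 1) (\<phi> p) (differential M \<phi> p v) (\<tau> p) (differential M \<phi> p w))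
      = trace_on ?T (\<lambda>v w. (v \<bullet> w) *\<^sub>R (- \<tau> p))"
  proof (rule trace_on_cong[OF subspace_tangent[OF p]])
    fix v assume v: "v \<in> ?T"
    show "curvature (sphere 0 1) (\<phi> p) (differential M \<phi> p v) (\<tau> p) (differential M \<phi> p v)
        = (v \<bullet> v) *\<^sub>R (- \<tau> p)"
      using curvature_sphere[OF phi_in_sphere[OF p], of "differential M \<phi> p v" "\<tau> p" "differential M \<phi> p v"]
        phi_orthogonal[OF p v] tension_phi[OF p] tension_normal[OF p v] differential_isometric[OF p v v]
      by (simp add: inner_commute)
  qed
  also have "\<dots> = - real m *\<^sub>R \<tau> p"
    using trace_on_inner[OF subspace_tangent[OF p], of "- \<tau> p"] by (simp add: dim_tangent p)
  finally show ?thesis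
    by (simp add: bitension_field_def rough_laplacian_tension p)
qed

lemma bitension_tangent: "p \<in> M \<Longrightarrow> \<phi> p \<bullet> bitension_field M (sphere 0 1) \<phi> p = 0"
  by (simp add: bitension_field_eq inner_diff_right tension_phi phi_laplacian_tension phi_inner_phi)

lemma laplacian_tension:
  assumes p: "p \<in> M"
  shows "\<Delta> \<tau> p = real m *\<^sub>R \<Delta> \<phi> p - \<Delta> (\<Delta> \<phi>) p"
proof -
  have "\<Delta> \<tau> p = \<Delta> (\<lambda>q. real m *\<^sub>R \<phi> q - \<Delta> \<phi> q) p"
    by (rule laplacian_cong[OF smooth_tension p tension_field_eq])
  then show ?thesis
    by (simp add: laplacian_diff laplacian_scaleR smooth_map_on_scaleR smooth_phi smooth_laplacian p)
qed

end

section \<open>Constant mean curvature and finite type\<close>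

locale constant_mean_curvature = spherical_immersion m M \<phi>
  for m and M :: "'b::euclidean_space set" and \<phi> :: "'b \<Rightarrow> 'a::euclidean_space" +
  fixes k :: real
  assumes m_pos: "0 < m" and tension_norm: "p \<in> M \<Longrightarrow> \<tau> p \<bullet> \<tau> p = (real m)\<^sup>2 * k"
begin

text \<open>
  Substitute \<open>\<tau> = m \<phi> - \<Delta>\<phi>\<close>. As a polynomial in \<open>\<Delta>\<close> the result has the roots \<open>m (1 \<plusminus> \<surd>k)\<close>.
\<close>

lemma bitension_laplacian:
  assumes p: "p \<in> M"
  shows "bitension_field M (sphere 0 1) \<phi> p
    = \<Delta> (\<Delta> \<phi>) p - (2 * real m) *\<^sub>R \<Delta> \<phi> p + ((real m)\<^sup>2 * (1 - k)) *\<^sub>R \<phi> p"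
proof -
  have "(2 * real m) *\<^sub>R x = real m *\<^sub>R x + real m *\<^sub>R x" for x :: 'a
    by (simp flip: scaleR_left_distrib)
  then show ?thesis
    unfolding bitension_field_eq[OF p] tension_norm[OF p] laplacian_tension[OF p]
    unfolding tension_field_eq[OF p]
    by (simp add: power2_eq_square algebra_simps)
qed

text \<open>
  The divergence of \<open>\<tau> \<bullet> \<nabla>\<tau>\<close>, which is zero because \<open>|\<tau>|\<close> is constant.
\<close>

lemma sum_tder_tension:
  assumes p: "p \<in> M"
  shows "(\<Sum>i\<in>Basis. tder M i \<tau> p \<bullet> tder M i \<tau> p) = \<tau> p \<bullet> \<Delta> \<tau> p"
proof -
  have 0: "\<tau> q \<bullet> tder M i \<tau> q = 0" if q: "q \<in> M" for q i
  proof -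
    have "tder M i (\<lambda>q. \<tau> q \<bullet> \<tau> q) q = tder M i (\<lambda>q. (real m)\<^sup>2 * k) q"
      by (rule tder_cong[OF q]) (rule tension_norm)
    then show ?thesis
      by (simp add: tder_inner smooth_tension q tder_const inner_commute)
  qed
  have "tder M i (\<lambda>q. \<tau> q \<bullet> tder M i \<tau> q) p = tder M i (\<lambda>q. 0::real) p" for i
    by (rule tder_cong[OF p]) (rule 0)
  then show ?thesis
    using sum_tder_inner[OF smooth_tension smooth_tension p] by (simp add: tder_const p)
qed

text \<open>
  Expanding the square gives \<open>m\<^sup>2 |d\<phi>|\<^sup>2 + 2m d\<phi> \<bullet> d\<tau> + |d\<tau>|\<^sup>2\<close>. Here \<open>|d\<phi>|\<^sup>2 = m\<close> and \<open>d\<phi> \<bullet> d\<tau> = - |\<tau>|\<^sup>2\<close>, while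
  \<open>|d\<tau>|\<^sup>2 = \<tau> \<bullet> \<Delta>\<tau>\<close> is \<open>m |\<tau>|\<^sup>2\<close> by biharmonicity. The identity forces \<open>k \<le> 1\<close>, and in the case of equality it
  shows that \<open>m \<phi> + \<tau>\<close> has zero differential.
\<close>

lemma biharmonic_gradient_identity:
  assumes p: "p \<in> M" and biharmonic: "bitension_field M (sphere 0 1) \<phi> p = 0"
  shows "(\<Sum>i\<in>Basis. (norm (tder M i (\<lambda>q. real m *\<^sub>R \<phi> q + \<tau> q) p))\<^sup>2) = real m ^ 3 * (1 - k)"
proof -
  have "\<Delta> \<tau> p = real m *\<^sub>R \<tau> p - ((real m)\<^sup>2 * k) *\<^sub>R \<phi> p"
    using biharmonic by (simp add: bitension_field_eq p tension_norm algebra_simps)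
  then have "\<tau> p \<bullet> \<Delta> \<tau> p = real m * ((real m)\<^sup>2 * k)"
    using tension_phi[OF p] tension_norm[OF p] by (simp add: inner_diff_right inner_commute)
  then have \<tau>: "(\<Sum>i\<in>Basis. tder M i \<tau> p \<bullet> tder M i \<tau> p) = real m * ((real m)\<^sup>2 * k)"
    by (simp add: sum_tder_tension p)
  have "(norm (tder M i (\<lambda>q. real m *\<^sub>R \<phi> q + \<tau> q) p))\<^sup>2 = (real m)\<^sup>2 * (tder M i \<phi> p \<bullet> tder M i \<phi> p)
      + 2 * real m * (tder M i \<phi> p \<bullet> tder M i \<tau> p) + tder M i \<tau> p \<bullet> tder M i \<tau> p" for i
  proof -
    have "tder M i (\<lambda>q. real m *\<^sub>R \<phi> q + \<tau> q) p = real m *\<^sub>R tder M i \<phi> p + tder M i \<tau> p"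
      by (simp add: tder_add smooth_map_on_scaleR smooth_phi smooth_tension p
          tder_bounded_linear[OF bounded_linear_scaleR_right])
    then show ?thesis
      unfolding power2_norm_eq_inner
      by (simp add: power2_eq_square inner_add_left inner_add_right inner_commute algebra_simps)
  qed
  then show ?thesis
    using sum_tder_phi[OF p] sum_tder_phi_tension[OF p] \<tau> tension_norm[OF p]
    by (simp add: sum.distrib sum_distrib_left[symmetric] power2_eq_square power3_eq_cube algebra_simps)
qed

lemma harmonic_iff:
  assumes "M \<noteq> {}"
  shows "harmonic_map M (sphere 0 1) \<phi> \<longleftrightarrow> k = 0"
proof -
  have "\<tau> p = 0 \<longleftrightarrow> k = 0" if "p \<in> M" for p
    using tension_norm[OF that] m_pos by (metis inner_eq_zero_iff mult_eq_0_iff of_nat_0_less_iff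
        less_numeral_extra(3) power_not_zero)
  then show ?thesis using assms unfolding harmonic_map_def by blast
qed

lemma k_nonneg: "M \<noteq> {} \<Longrightarrow> 0 \<le> k"
  using tension_norm m_pos inner_ge_zero[of "\<tau> _"]
  by (metis all_not_in_conv mult_le_cancel_left_pos mult_zero_right of_nat_0_less_iff zero_less_power)

lemma biharmonic_k_le_1:
  assumes p: "p \<in> M" and "bitension_field M (sphere 0 1) \<phi> p = 0"
  shows "k \<le> 1"
proof -
  have "0 \<le> real m ^ 3 * (1 - k)"
    unfolding biharmonic_gradient_identity[OF assms, symmetric] by (intro sum_nonneg) simp
  then show ?thesis
    using m_pos by (simp add: zero_le_mult_iff)
qed

text \<open>
  The constant part of \<open>\<phi>\<close> is \<open>(m \<phi> + \<tau>) / 2m\<close>, so that the other summand is \<open>\<Delta>\<phi> / 2m\<close>. It is an eigenfunction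
  because \<open>\<Delta>\<^sup>2\<phi> = 2m \<Delta>\<phi>\<close>.
\<close>

lemma finite_type_1:
  assumes "connected M" "M \<noteq> {}" and k: "k = 1" and biharmonic: "biharmonic_map M (sphere 0 1) \<phi>"
  shows "finite_type M \<phi> 1 {2 * real m}"
proof -
  have bit: "bitension_field M (sphere 0 1) \<phi> p = 0" if "p \<in> M" for p
    using biharmonic that by (simp add: biharmonic_map_def)
  let ?f = "\<lambda>q. real m *\<^sub>R \<phi> q + \<tau> q"
  obtain p0 where p0: "p0 \<in> M" using assms(2) by blast
  have f: "smooth_map_on M ?f"
    by (intro smooth_map_on_add smooth_map_on_scaleR smooth_phi smooth_tension)
  have "tder M i ?f p = 0" if "p \<in> M" "i \<in> Basis" for p i
    using biharmonic_gradient_identity[OF that(1) bit[OF that(1)]] that(2) k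
    by (simp add: sum_nonneg_eq_0_iff)
  then have const: "?f p = ?f p0" if "p \<in> M" for p
    using constant_if_tder_eq_0[OF assms(1) f] that p0 by blast
  define x c where "x = (\<lambda>q. (1 / (2 * real m)) *\<^sub>R \<Delta> \<phi> q)" and "c = (1 / (2 * real m)) *\<^sub>R ?f p0"
  have "smooth_map_on M x"
    unfolding x_def by (intro smooth_map_on_scaleR smooth_laplacian smooth_phi)
  moreover have "x p0 \<noteq> 0"
    using phi_laplacian[OF p0] m_pos by (auto simp: x_def)
  moreover have "\<Delta> x p = (2 * real m) *\<^sub>R x p" if p: "p \<in> M" for p
    using bit[OF p] m_pos k unfolding x_def
    by (simp add: laplacian_scaleR smooth_laplacian smooth_phi p bitension_laplacian)
  moreover have "\<phi> p = c + x p" if p: "p \<in> M" for p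
  proof -
    have "(1 / (2 * real m)) *\<^sub>R ?f p + x p = (1 / (2 * real m)) *\<^sub>R (2 * real m) *\<^sub>R \<phi> p"
      unfolding x_def tension_field_eq[OF p] scaleR_right_distrib[symmetric]
      by (simp add: scaleR_2 flip: scaleR_scaleR)
    then show ?thesis using m_pos const[OF p] by (simp add: c_def)
  qed
  ultimately show ?thesis
    unfolding finite_type_def using m_pos p0
    by (intro conjI exI[of _ c] exI[of _ "\<lambda>_. x"]) auto
qed

text \<open>
  For the two roots \<open>\<alpha>\<close> and \<open>\<beta>\<close> of the polynomial, \<open>(\<Delta> - \<beta>) \<phi>\<close> and \<open>(\<Delta> - \<alpha>) \<phi>\<close> are eigenfunctions for \<open>\<alpha>\<close> and \<open>\<beta>\<close>,
  and their difference is \<open>(\<alpha> - \<beta>) \<phi>\<close>.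
\<close>

lemma finite_type_2:
  assumes "M \<noteq> {}" "0 < k" "k < 1" and biharmonic: "biharmonic_map M (sphere 0 1) \<phi>"
  shows "finite_type M \<phi> 2 {real m * (1 + sqrt k), real m * (1 - sqrt k)}"
proof -
  define s \<alpha> \<beta> where "s = sqrt k" and "\<alpha> = real m * (1 + s)" and "\<beta> = real m * (1 - s)"
  have s: "0 < s" "s < 1" "s\<^sup>2 = k"
    using assms(2,3) by (auto simp: s_def)
  have pos: "0 < \<alpha>" "0 < \<beta>" "0 < \<alpha> - \<beta>" "\<alpha> \<noteq> \<beta>"
    using s m_pos by (auto simp: \<alpha>_def \<beta>_def)
  have sum: "2 * real m = \<alpha> + \<beta>" and prod: "(real m)\<^sup>2 * (1 - k) = \<alpha> * \<beta>"
    using s by (auto simp: \<alpha>_def \<beta>_def algebra_simps power2_eq_square)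
  have \<Delta>\<Delta>: "\<Delta> (\<Delta> \<phi>) p = (\<alpha> + \<beta>) *\<^sub>R \<Delta> \<phi> p - (\<alpha> * \<beta>) *\<^sub>R \<phi> p" if "p \<in> M" for p
    using biharmonic bitension_laplacian[OF that] that unfolding sum prod biharmonic_map_def
    by (simp add: algebra_simps)
  obtain p0 where p0: "p0 \<in> M" using assms(1) by blast
  \<comment> \<open>For \<open>\<nu>\<close> one of the roots, \<open>\<alpha> + \<beta> - \<nu>\<close> is the other one.\<close>
  define x where "x = (\<lambda>\<nu> q. (if \<nu> = \<alpha> then 1 else - 1) *\<^sub>R (1 / (\<alpha> - \<beta>)) *\<^sub>R
    (\<Delta> \<phi> q - (\<alpha> + \<beta> - \<nu>) *\<^sub>R \<phi> q))"
  have "smooth_map_on M (x \<nu>)" for \<nu>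
    unfolding x_def
    by (intro smooth_map_on_scaleR smooth_map_on_diff smooth_laplacian smooth_phi)
  moreover have "x \<nu> p0 \<noteq> 0" if "\<nu> \<in> {\<alpha>, \<beta>}" for \<nu>
  proof
    assume "x \<nu> p0 = 0"
    then have "\<Delta> \<phi> p0 = (\<alpha> + \<beta> - \<nu>) *\<^sub>R \<phi> p0"
      using pos by (auto simp: x_def split: if_splits)
    then have "real m = \<alpha> + \<beta> - \<nu>"
      using phi_laplacian[OF p0] phi_inner_phi[OF p0] by simp
    then show False
      using that m_pos s(1) by (auto simp: \<alpha>_def \<beta>_def algebra_simps)
  qed
  moreover have "\<Delta> (x \<nu>) p = \<nu> *\<^sub>R x \<nu> p" if p: "p \<in> M" and \<nu>: "\<nu> \<in> {\<alpha>, \<beta>}" for \<nu> p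
  proof -
    let ?y = "\<lambda>q. \<Delta> \<phi> q - (\<alpha> + \<beta> - \<nu>) *\<^sub>R \<phi> q"
    have y: "smooth_map_on M ?y"
      by (intro smooth_map_on_scaleR smooth_map_on_diff smooth_laplacian smooth_phi)
    have "\<Delta> ?y p = \<Delta> (\<Delta> \<phi>) p - (\<alpha> + \<beta> - \<nu>) *\<^sub>R \<Delta> \<phi> p"
      by (simp add: laplacian_diff laplacian_scaleR smooth_map_on_scaleR smooth_laplacian smooth_phi p)
    also have "\<dots> = \<nu> *\<^sub>R \<Delta> \<phi> p - (\<alpha> * \<beta>) *\<^sub>R \<phi> p"
      by (simp add: \<Delta>\<Delta> p algebra_simps)
    also have "\<dots> = \<nu> *\<^sub>R ?y p"
      using \<nu> by (auto simp: algebra_simps)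
    finally show ?thesis
      unfolding x_def by (simp add: laplacian_scaleR smooth_map_on_scaleR y p mult.commute)
  qed
  moreover have "\<phi> p = 0 + (\<Sum>\<nu>\<in>{\<alpha>, \<beta>}. x \<nu> p)" for p
  proof -
    have "(\<Sum>\<nu>\<in>{\<alpha>, \<beta>}. x \<nu> p) = (1 / (\<alpha> - \<beta>)) *\<^sub>R (\<Delta> \<phi> p - \<beta> *\<^sub>R \<phi> p)
        - (1 / (\<alpha> - \<beta>)) *\<^sub>R (\<Delta> \<phi> p - \<alpha> *\<^sub>R \<phi> p)"
      using pos(4) by (simp add: x_def)
    also have "\<dots> = (1 / (\<alpha> - \<beta>)) *\<^sub>R ((\<Delta> \<phi> p - \<beta> *\<^sub>R \<phi> p) - (\<Delta> \<phi> p - \<alpha> *\<^sub>R \<phi> p))"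
      by (simp only: scaleR_right_diff_distrib)
    also have "(\<Delta> \<phi> p - \<beta> *\<^sub>R \<phi> p) - (\<Delta> \<phi> p - \<alpha> *\<^sub>R \<phi> p) = (\<alpha> - \<beta>) *\<^sub>R \<phi> p"
      by (simp add: algebra_simps)
    finally have "(\<Sum>\<nu>\<in>{\<alpha>, \<beta>}. x \<nu> p) = (1 / (\<alpha> - \<beta>)) *\<^sub>R ((\<alpha> - \<beta>) *\<^sub>R \<phi> p)" .
    then show ?thesis using pos(3) by simp
  qed
  ultimately have "finite_type M \<phi> 2 {\<alpha>, \<beta>}"
    unfolding finite_type_def using pos p0
    by (intro conjI exI[of _ 0] exI[of _ x]) auto
  then show ?thesis by (simp add: \<alpha>_def \<beta>_def s_def)
qed

lemma finite_type_1_biharmonic: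
  assumes k: "k = 1" and "finite_type M \<phi> 1 {2 * real m}"
  shows "biharmonic_map M (sphere 0 1) \<phi>"
proof -
  obtain x0 x where x: "smooth_map_on M x" "\<And>p. p \<in> M \<Longrightarrow> \<Delta> x p = (2 * real m) *\<^sub>R x p"
    and \<phi>: "\<And>p. p \<in> M \<Longrightarrow> \<phi> p = x0 + x p"
    using assms(2) unfolding finite_type_def by auto
  have \<Delta>: "\<Delta> \<phi> p = (2 * real m) *\<^sub>R x p" if p: "p \<in> M" for p
  proof -
    have "\<Delta> \<phi> p = \<Delta> (\<lambda>q. x0 + x q) p"
      by (rule laplacian_cong[OF smooth_phi p \<phi>])
    then show ?thesis
      by (simp add: laplacian_add smooth_map_on_const x p laplacian_const)
  qed
  have "\<Delta> (\<Delta> \<phi>) p = (2 * real m) *\<^sub>R \<Delta> \<phi> p" if p: "p \<in> M" for p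
  proof -
    have "\<Delta> (\<Delta> \<phi>) p = \<Delta> (\<lambda>q. (2 * real m) *\<^sub>R x q) p"
      by (rule laplacian_cong[OF smooth_laplacian[OF smooth_phi] p \<Delta>])
    then show ?thesis
      by (simp add: laplacian_scaleR x p \<Delta>)
  qed
  then show ?thesis
    by (simp add: biharmonic_map_def bitension_laplacian k)
qed

text \<open>
  The spectral decomposition makes the bitension field constant. Being tangent to the
  sphere it is orthogonal to \<open>\<phi>\<close> everywhere, hence also to \<open>\<Delta>\<phi>\<close> and \<open>\<Delta>\<^sup>2\<phi>\<close>, and so to itself.
\<close>

lemma finite_type_2_biharmonic:
  assumes k: "0 < k" "k < 1" and "finite_type M \<phi> 2 {real m * (1 + sqrt k), real m * (1 - sqrt k)}"
  shows "biharmonic_map M (sphere 0 1) \<phi>"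
proof -
  define s \<alpha> \<beta> where "s = sqrt k" and "\<alpha> = real m * (1 + s)" and "\<beta> = real m * (1 - s)"
  have s: "0 < s" "s\<^sup>2 = k"
    using k by (auto simp: s_def)
  have ne: "\<alpha> \<noteq> \<beta>"
    using s m_pos by (auto simp: \<alpha>_def \<beta>_def)
  have sum: "2 * real m = \<alpha> + \<beta>" and prod: "(real m)\<^sup>2 * (1 - k) = \<alpha> * \<beta>"
    using s by (auto simp: \<alpha>_def \<beta>_def algebra_simps power2_eq_square)
  have "finite_type M \<phi> 2 {\<alpha>, \<beta>}"
    using assms(3) by (simp add: \<alpha>_def \<beta>_def s_def)
  then obtain x0 x where x: "\<forall>\<nu>\<in>{\<alpha>, \<beta>}. smooth_map_on M (x \<nu>) \<and> (\<exists>p\<in>M. x \<nu> p \<noteq> 0) \<and>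
      (\<forall>p\<in>M. \<Delta> (x \<nu>) p = \<nu> *\<^sub>R x \<nu> p)"
    and \<phi>': "\<forall>p\<in>M. \<phi> p = x0 + (\<Sum>\<nu>\<in>{\<alpha>, \<beta>}. x \<nu> p)"
    unfolding finite_type_def by (elim conjE exE) (rule that)
  define y z where "y = x \<alpha>" and "z = x \<beta>"
  have y: "smooth_map_on M y" "\<And>p. p \<in> M \<Longrightarrow> \<Delta> y p = \<alpha> *\<^sub>R y p"
    and z: "smooth_map_on M z" "\<And>p. p \<in> M \<Longrightarrow> \<Delta> z p = \<beta> *\<^sub>R z p"
    using x by (simp_all add: y_def z_def)
  have \<phi>: "\<phi> p = x0 + (y p + z p)" if "p \<in> M" for p
    using bspec[OF \<phi>' that] ne by (simp add: y_def z_def)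
  have \<Delta>: "\<Delta> \<phi> p = \<alpha> *\<^sub>R y p + \<beta> *\<^sub>R z p" if p: "p \<in> M" for p
  proof -
    have "\<Delta> \<phi> p = \<Delta> (\<lambda>q. x0 + (y q + z q)) p"
      by (rule laplacian_cong[OF smooth_phi p \<phi>])
    then show ?thesis
      by (simp add: laplacian_add smooth_map_on_const smooth_map_on_add y z p laplacian_const)
  qed
  have \<Delta>\<Delta>: "\<Delta> (\<Delta> \<phi>) p = (\<alpha> * \<alpha>) *\<^sub>R y p + (\<beta> * \<beta>) *\<^sub>R z p" if p: "p \<in> M" for p
  proof -
    have "\<Delta> (\<Delta> \<phi>) p = \<Delta> (\<lambda>q. \<alpha> *\<^sub>R y q + \<beta> *\<^sub>R z q) p"
      by (rule laplacian_cong[OF smooth_laplacian[OF smooth_phi] p \<Delta>])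
    then show ?thesis
      by (simp add: laplacian_add laplacian_scaleR smooth_map_on_scaleR y z p)
  qed
  define c where "c = (\<alpha> * \<beta>) *\<^sub>R x0"
  have c: "bitension_field M (sphere 0 1) \<phi> p = c" if p: "p \<in> M" for p
    unfolding bitension_laplacian[OF p] sum prod \<Delta>\<Delta>[OF p] \<Delta>[OF p] \<phi>[OF p] c_def
    by (simp add: algebra_simps)
  have 0: "\<phi> p \<bullet> c = 0" if "p \<in> M" for p
    using bitension_tangent[OF that] c[OF that] by simp
  have step: "\<Delta> f p \<bullet> c = 0"
    if f: "smooth_map_on M f" and 0: "\<And>q. q \<in> M \<Longrightarrow> f q \<bullet> c = 0" and p: "p \<in> M" for f p
  proof -
    have "\<Delta> f p \<bullet> c = \<Delta> (\<lambda>q. f q \<bullet> c) p"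
      by (rule laplacian_bounded_linear[OF bounded_linear_inner_left f p, symmetric])
    also have "\<dots> = \<Delta> (\<lambda>q. 0) p"
      by (rule laplacian_cong[OF smooth_map_on_bounded_linear[OF bounded_linear_inner_left f] p 0])
    finally show ?thesis by (simp add: laplacian_const p)
  qed
  have 1: "\<Delta> \<phi> p \<bullet> c = 0" if "p \<in> M" for p
    by (rule step[OF smooth_phi _ that]) (rule 0)
  have 2: "\<Delta> (\<Delta> \<phi>) p \<bullet> c = 0" if "p \<in> M" for p
    by (rule step[OF smooth_laplacian[OF smooth_phi] _ that]) (rule 1)
  have "bitension_field M (sphere 0 1) \<phi> p = 0" if p: "p \<in> M" for p
  proof -
    have "bitension_field M (sphere 0 1) \<phi> p \<bullet> c = 0"
      unfolding bitension_laplacian[OF p] using 0[OF p] 1[OF p] 2[OF p]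
      by (simp add: inner_add_left inner_diff_left)
    then show ?thesis using c[OF p] by simp
  qed
  then show ?thesis by (simp add: biharmonic_map_def)
qed

end

theorem theorem3p1:
  fixes M :: "'b::euclidean_space set"
    and \<phi> :: "'b \<Rightarrow> 'a::euclidean_space"
    and m n :: nat
    and k :: real
  assumes "DIM('a) = n + 1"
    and "1 \<le> m"
    and "smooth_submanifold m M" "connected M" "M \<noteq> {}"
    and "compact M"
    and "isometric_immersion M (sphere (0::'a) 1) \<phi>"
    and "\<And>p. p \<in> M \<Longrightarrow> (norm (mean_curvature_vector m M (sphere 0 1) \<phi> p))\<^sup>2 = k"
  shows "proper_biharmonic M (sphere 0 1) \<phi> \<longleftrightarrow>
           k = 1 \<and> finite_type M \<phi> 1 {2 * real m} \<or>
           k \<in> {0<..<1} \<and>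
             finite_type M \<phi> 2 {real m * (1 + sqrt k), real m * (1 - sqrt k)}"
proof -
  interpret spherical_immersion m M \<phi>
    using assms(3,7) by unfold_locales
  interpret constant_mean_curvature m M \<phi> k
  proof
    show "0 < m" using assms(2) by simp
    show "\<tau> p \<bullet> \<tau> p = (real m)\<^sup>2 * k" if p: "p \<in> M" for p
    proof -
      have "\<tau> p = real m *\<^sub>R mean_curvature_vector m M (sphere 0 1) \<phi> p"
        using mean_curvature_vector_eq[OF p] assms(2) by simp
      then show ?thesis
        using assms(8)[OF p, unfolded power2_norm_eq_inner] by (simp add: power2_eq_square)
    qed
  qed
  show ?thesis
  proof
    assume "proper_biharmonic M (sphere 0 1) \<phi>"
    then have bi: "biharmonic_map M (sphere 0 1) \<phi>" and "k \<noteq> 0"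
      using harmonic_iff assms(5) by (auto simp: proper_biharmonic_def)
    moreover have "k \<le> 1"
      using bi biharmonic_k_le_1 assms(5) by (auto simp: biharmonic_map_def)
    ultimately have "0 < k" "k = 1 \<or> k < 1"
      using k_nonneg assms(5) by auto
    then show "k = 1 \<and> finite_type M \<phi> 1 {2 * real m} \<or>
        k \<in> {0<..<1} \<and> finite_type M \<phi> 2 {real m * (1 + sqrt k), real m * (1 - sqrt k)}"
      using finite_type_1[OF assms(4,5) _ bi] finite_type_2[OF assms(5) _ _ bi] by auto
  next
    assume "k = 1 \<and> finite_type M \<phi> 1 {2 * real m} \<or>
        k \<in> {0<..<1} \<and> finite_type M \<phi> 2 {real m * (1 + sqrt k), real m * (1 - sqrt k)}"
    then have "biharmonic_map M (sphere 0 1) \<phi>" "k \<noteq> 0"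
      using finite_type_1_biharmonic finite_type_2_biharmonic by auto
    then show "proper_biharmonic M (sphere 0 1) \<phi>"
      using harmonic_iff assms(5) by (simp add: proper_biharmonic_def)
  qed
qed

end
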